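(* Let $N=\{(\psi_0,c,t)\in\mathbb R^3: 0<t<\mathbf t(\psi_0,c)\}$. Then $\operatorname{Exp}(N)\subset\operatorname{int}\mathcal B_2$. Moreover, the mapping $\operatorname{Exp}:N\to\operatorname{int}\mathcal B_2$ is a real-analytic diffeomorphism.
   Context: Exponential mapping. For $(\psi_0,c)\in\mathbb R^2$ let $(\psi,x,y,z)(t)$ be the solution of $\dot\psi=cx$, $\dot x=\cosh\psi$, $\dot y=\sinh\psi$, $\dot z=\frac{x^2}{2}\sinh\psi$ ($c$ constant) with $\psi(0)=\psi_0$, $x(0)=y(0)=z(0)=0$; set $\operatorname{Exp}(\psi_0,c,t)=(x(t),y(t),z(t))\in\mathbb R^3$ for $0<t<\mathbf t(\psi_0,c)$, where $\mathbf t(\psi_0,c)$ is the forward lifetime of this solution: $\mathbf t=+\infty$ if $c=0$, and if $c\ne0$, $\mathbf t=\frac{K(k)}{\text{\ae}\sqrt{|c|}}$ with $E=-\sinh\psi_0$, $\text{\ae}=\sqrt{\sqrt{1+E^2}/2}$, $k=\sqrt{\frac12\big(1+\operatorname{sgn}(c)\frac{E}{\sqrt{1+E^2}}\big)}$, $K(k)=\int_0^{\pi/2}\frac{d\theta}{\sqrt{1-k^2\sin^2\theta}}$. (These are the arclength-parametrized normal extremal trajectories from the origin of the problem $\dot q=u_1X_1+u_2X_2$, $u_1\ge|u_2|$, $\int\sqrt{u_1^2-u_2^2}\,dt\to\max$, with $X_1=\partial_x$, $X_2=\partial_y+\frac{x^2}{2}\partial_z$.) The set $\mathcal B_2$: $$\mathcal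 B_2=\Big\{(x,y,z)\in\mathbb R^3:\ x\ge|y|,\ \tfrac{(x+y)^3-4x^3}{24}\le z\le\tfrac{4x^3-(x-y)^3}{24}\Big\}.$$ *)

theory Defs
  imports "HOL-Analysis.Analysis"
begin

text \<open>
  Real-analyticity in several variables: around every point of \<open>S\<close> the function is the sum of a
  power series in the coordinates. Multi-indices are the extensional functions from \<open>Basis\<close>
  to \<open>nat\<close>; \<open>has_sum\<close> is unconditional, so no ordering of the multi-indices is needed.
  As for \<open>analytic_on\<close>, the expansion holds on a full neighbourhood of each point;
  for open \<open>S\<close> the values of \<open>f\<close> outside \<open>S\<close> are irrelevant.
\<close>

definition real_analytic_on ::
    "('a::euclidean_space \<Rightarrow> 'b::euclidean_space) \<Rightarrow> 'a set \<Rightarrow> bool" where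
  "real_analytic_on f S \<longleftrightarrow>
     (\<forall>a\<in>S. \<exists>r>0. \<exists>C. \<forall>x\<in>ball a r.
        ((\<lambda>\<alpha>. (\<Prod>b\<in>Basis. ((x - a) \<bullet> b) ^ \<alpha> b) *\<^sub>R C \<alpha>) has_sum f x)
          (Basis \<rightarrow>\<^sub>E (UNIV :: nat set)))"

definition real_analytic_diffeomorphism ::
    "('a::euclidean_space \<Rightarrow> 'b::euclidean_space) \<Rightarrow> 'a set \<Rightarrow> 'b set \<Rightarrow> bool" where
  "real_analytic_diffeomorphism f U V \<longleftrightarrow>
     open U \<and> open V \<and> bij_betw f U V \<and>
     real_analytic_on f U \<and> real_analytic_on (the_inv_into U f) V"

definition extremal ::
    "real \<Rightarrow> real \<Rightarrow> real set \<Rightarrow>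
     (real \<Rightarrow> real) \<Rightarrow> (real \<Rightarrow> real) \<Rightarrow> (real \<Rightarrow> real) \<Rightarrow> (real \<Rightarrow> real) \<Rightarrow> bool" where
  "extremal \<psi>0 c I \<psi> x y z \<longleftrightarrow>
     \<psi> 0 = \<psi>0 \<and> x 0 = 0 \<and> y 0 = 0 \<and> z 0 = 0 \<and>
     (\<forall>s\<in>I. (\<psi> has_real_derivative c * x s) (at s within I) \<and>
            (x has_real_derivative cosh (\<psi> s)) (at s within I) \<and>
            (y has_real_derivative sinh (\<psi> s)) (at s within I) \<and>
            (z has_real_derivative (x s)\<^sup>2 / 2 * sinh (\<psi> s)) (at s within I))"

text \<open>
  The endpoint at time \<open>t\<close> of the solution of the initial value problem. It is meaningful
  exactly when the solution lives on all of \<open>[0, t]\<close>.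
\<close>

definition Exp_map :: "real \<times> real \<times> real \<Rightarrow> real \<times> real \<times> real" where
  "Exp_map = (\<lambda>(\<psi>0, c, t).
     THE q. \<exists>\<psi> x y z. extremal \<psi>0 c {0..t} \<psi> x y z \<and> q = (x t, y t, z t))"

text \<open>Complete elliptic integral of the first kind, as a function of the modulus \<open>k\<close>.\<close>

definition elliptic_K :: "real \<Rightarrow> real" where
  "elliptic_K k = integral {0..pi/2} (\<lambda>\<theta>. 1 / sqrt (1 - k\<^sup>2 * (sin \<theta>)\<^sup>2))"

definition lifetime :: "real \<Rightarrow> real \<Rightarrow> ereal" where
  "lifetime \<psi>0 c =
     (if c = 0 then \<infinity>
      else let E = - sinh \<psi>0;
               ae = sqrt (sqrt (1 + E\<^sup>2) / 2);
               k = sqrt (1/2 * (1 + sgn c * (E / sqrt (1 + E\<^sup>2))))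
           in ereal (elliptic_K k / (ae * sqrt \<bar>c\<bar>)))"

definition Exp_dom :: "(real \<times> real \<times> real) set" where
  "Exp_dom = {(\<psi>0, c, t). 0 < t \<and> ereal t < lifetime \<psi>0 c}"

definition B2 :: "(real \<times> real \<times> real) set" where
  "B2 = {(x, y, z). \<bar>y\<bar> \<le> x \<and>
           ((x + y)^3 - 4 * x^3) / 24 \<le> z \<and> z \<le> (4 * x^3 - (x - y)^3) / 24}"

end

theory Submission
  imports Defs "HOL-Complex_Analysis.Complex_Analysis"
begin

text \<open>
  Along an extremal \<open>sinh \<psi> - c x\<^sup>2 / 2\<close> is constant. With \<open>s = sinh \<psi>0\<close> and \<open>a = c / 2\<close> the whole
  trajectory is therefore a function of its abscissa \<open>x\<close>, which increases: \<open>sinh \<psi> = s + a x\<^sup>2\<close>,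
  and \<open>dt/dx\<close>, \<open>dy/dx\<close>, \<open>dz/dx\<close> are \<open>\<kappa>(s + a x\<^sup>2)\<close>, \<open>\<gamma>(s + a x\<^sup>2)\<close>, \<open>x\<^sup>2/2 \<gamma>(s + a x\<^sup>2)\<close> for the kernels
  \<open>\<kappa> v = 1 / sqrt (1 + v\<^sup>2)\<close> and \<open>\<gamma> v = v / sqrt (1 + v\<^sup>2)\<close>. Rescaling the integrals to \<open>[0, 1]\<close> and putting
  \<open>b = a x\<^sup>2\<close> expresses everything through the moments \<open>M\<^sub>m[\<kappa>](s, b) = \<integral> \<eta>\<^sup>m \<kappa>(s + b \<eta>\<^sup>2) d\<eta>\<close>: at
  \<open>u = (\<psi>0, b, x)\<close> in the half-space \<open>x > 0\<close>, the parameters and the endpoint are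
  \<open>P u = (\<psi>0, 2 b / x\<^sup>2, x M\<^sub>0[\<kappa>])\<close> and \<open>Q u = (x, x M\<^sub>0[\<gamma>], x\<^sup>3 M\<^sub>2[\<gamma>] / 2)\<close>,
  so that \<open>Exp \<circ> P = Q\<close>. It remains to see that \<open>P\<close> and \<open>Q\<close> are bijections of the half-space onto the
  domain of the exponential mapping and onto the interior of \<open>B2\<close>, and that the two transition maps
  \<open>Q \<circ> P\<^sup>-\<^sup>1\<close> and \<open>P \<circ> Q\<^sup>-\<^sup>1\<close> are real-analytic.

  The map \<open>P\<close> is injective because time increases with \<open>x\<close>, and its image is the stated domain because
  the substitution \<open>x = \<mu> tan (\<phi> / 2)\<close> turns the time integral into an elliptic integral whose complete
  value is the lifetime (\<open>exists_time_at_iff\<close>). For \<open>Q\<close> the point is that \<open>(M\<^sub>0[\<gamma>], M\<^sub>2[\<gamma>])\<close> is the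
  gradient in \<open>(s, b)\<close> of the strictly convex function \<open>\<Phi> = \<integral> sqrt (1 + (s + b \<eta>\<^sup>2)\<^sup>2) d\<eta>\<close>. Monotonicity of
  the gradient gives injectivity (\<open>tanh_arsinh_moments_inj\<close>). The values of the gradient are moments of a
  function with values in \<open>[-1, 1]\<close>, and comparison with bang-bang functions, which take only the values
  \<open>\<plusminus>1\<close> and switch once, shows both that they lie in the region defining \<open>B2\<close> (\<open>second_moment_le\<close>) and
  that \<open>\<Phi> - Y s - N b\<close> is coercive for \<open>(Y, N)\<close> inside this region, so that the gradient attains
  \<open>(Y, N)\<close> at a minimum (\<open>tanh_arsinh_moments_surj\<close>).

  For analyticity, \<open>P\<close> and \<open>Q\<close> extend to complex-differentiable maps on a neighbourhood of the half-space
  in \<open>\<complex>\<^sup>3\<close>, with injective derivative at real points: for \<open>Q\<close> by the strict Cauchy-Schwarz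
  inequality for moments, for \<open>P\<close> by an integration by parts. The inverse function theorem gives
  complex-differentiable local inverses, and complex-differentiable functions of three variables are sums
  of power series by the iterated Cauchy formula (\<open>complex_power_series\<close>). Invariance of domain makes
  sure that the local inverse takes real values at real points, so restriction to the reals gives
  the expansions of the transition maps (\<open>real_analytic_transition\<close>).
\<close>

section \<open>Power series of holomorphic functions of three complex variables\<close>

definition circ :: "real \<Rightarrow> real \<Rightarrow> complex" where
  "circ r \<theta> = of_real r * exp (2 * of_real pi * \<i> * of_real \<theta>)"

lemma norm_circ [simp]: "0 \<le> r \<Longrightarrow> norm (circ r \<theta>) = r"
  by (simp add: circ_def norm_mult)

lemma circ_nonzero: "0 < r \<Longrightarrow> circ r \<theta> \<noteq> 0"
  by (simp add: circ_def)

lemma continuous_on_circ [continuous_intros]: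
  "continuous_on A f \<Longrightarrow> continuous_on A (\<lambda>x. circ r (f x))"
  unfolding circ_def by (intro continuous_intros)

lemma Cauchy_coefficient_has_integral:
  assumes "continuous_on (cball 0 r) f" "f holomorphic_on ball 0 r" "0 < r"
  shows "((\<lambda>\<theta>. f (circ r \<theta>) / circ r \<theta> ^ n) has_integral (deriv ^^ n) f 0 / fact n) {0..1}"
proof -
  have "((\<lambda>u. f u / (u - 0) ^ Suc n) has_contour_integral
          (2 * pi * \<i>) / fact n * (deriv ^^ n) f 0) (circlepath 0 r)"
    by (rule Cauchy_has_contour_integral_higher_derivative_circlepath) (use assms in auto)
  moreover have path: "circlepath 0 r = circ r"
    by (simp add: circlepath circ_def fun_eq_iff)
  have "vector_derivative (circ r) (at \<theta>) = 2 * pi * \<i> * circ r \<theta>" for \<theta>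
    using vector_derivative_circlepath[of 0 r \<theta>] by (simp add: path circ_def)
  ultimately have "((\<lambda>\<theta>. f (circ r \<theta>) / circ r \<theta> ^ Suc n * (2 * pi * \<i> * circ r \<theta>))
      has_integral (2 * pi * \<i>) / fact n * (deriv ^^ n) f 0) {0..1}"
    unfolding has_contour_integral by (simp add: path)
  then have "((\<lambda>\<theta>. f (circ r \<theta>) / circ r \<theta> ^ Suc n * (2 * pi * \<i> * circ r \<theta>) / (2 * pi * \<i>))
      has_integral (2 * pi * \<i>) / fact n * (deriv ^^ n) f 0 / (2 * pi * \<i>)) {0..1}"
    by (rule has_integral_divide)
  moreover have "f (circ r \<theta>) / circ r \<theta> ^ Suc n * (2 * pi * \<i> * circ r \<theta>) / (2 * pi * \<i>)
      = f (circ r \<theta>) / circ r \<theta> ^ n" for \<theta>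
    using circ_nonzero[OF assms(3), of \<theta>] by (simp add: field_simps)
  ultimately show ?thesis by simp
qed

text \<open>
  A dominated family converges uniformly, so the net of finite partial sums may be integrated termwise.
\<close>

lemma has_sum_integral_dominated:
  fixes B :: "'i \<Rightarrow> real \<Rightarrow> complex"
  assumes "\<And>\<alpha>. continuous_on {0..1} (B \<alpha>)"
    and "\<And>\<alpha> \<theta>. \<alpha> \<in> S \<Longrightarrow> \<theta> \<in> {0..1} \<Longrightarrow> norm (B \<alpha> \<theta>) \<le> m \<alpha>"
    and "m summable_on S"
    and "\<And>\<theta>. \<theta> \<in> {0..1} \<Longrightarrow> ((\<lambda>\<alpha>. B \<alpha> \<theta>) has_sum F \<theta>) S"
  shows "((\<lambda>\<alpha>. integral {0..1} (B \<alpha>)) has_sum integral {0..1} F) S"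
proof -
  have "uniform_limit {0..1} (\<lambda>X \<theta>. \<Sum>\<alpha>\<in>X. B \<alpha> \<theta>) F (finite_subsets_at_top S)"
    by (rule Weierstrass_m_test_general'[where M = m]) (use assms in auto)
  then obtain I J where IJ: "\<And>X. ((\<lambda>\<theta>. \<Sum>\<alpha>\<in>X. B \<alpha> \<theta>) has_integral I X) {0..1}"
      "(F has_integral J) {0..1}" "(I \<longlongrightarrow> J) (finite_subsets_at_top S)"
    by (rule uniform_limit_integral) (use assms in \<open>auto intro!: continuous_intros\<close>)
  have "I X = (\<Sum>\<alpha>\<in>X. integral {0..1} (B \<alpha>))" for X
  proof (cases "finite X")
    case True
    have "integral {0..1} (\<lambda>\<theta>. \<Sum>\<alpha>\<in>X. B \<alpha> \<theta>) = (\<Sum>\<alpha>\<in>X. integral {0..1} (B \<alpha>))"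
      using True by (intro integral_sum integrable_continuous_interval assms)
    with integral_unique[OF IJ(1)[of X]] show ?thesis by simp
  next
    case False
    with integral_unique[OF IJ(1)[of X]] show ?thesis by simp
  qed
  then have "I = sum (\<lambda>\<alpha>. integral {0..1} (B \<alpha>))" by (rule ext)
  then show ?thesis
    using IJ(3) integral_unique[OF IJ(2)] by (simp add: has_sum_def)
qed

text \<open>
  One variable of the iterated Cauchy formula. If the values of \<open>F\<close> on the closed disc are already
  sums over an index set \<open>S\<close> with terms dominated by a summable \<open>m\<close>, then the expansion of \<open>F\<close> in \<open>z\<close>
  combines with them to a sum over \<open>UNIV \<times> S\<close>, again with a summable bound. The bound is what makes the
  double sum unconditional and what is passed on when the next variable is expanded.
\<close>

lemma power_expansion_step:
  fixes F :: "complex \<Rightarrow> complex" and B :: "'i \<Rightarrow> complex \<Rightarrow> complex"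
  assumes r: "0 < r" and z: "norm z < r"
    and F: "continuous_on (cball 0 r) F" "F holomorphic_on ball 0 r"
    and B: "\<And>\<alpha>. continuous_on (cball 0 r) (B \<alpha>)"
      "\<And>\<alpha> v. \<alpha> \<in> S \<Longrightarrow> norm v \<le> r \<Longrightarrow> norm (B \<alpha> v) \<le> m \<alpha>"
    and m: "m summable_on S"
    and sum: "\<And>v. norm v \<le> r \<Longrightarrow> ((\<lambda>\<alpha>. B \<alpha> v) has_sum F v) S"
  defines "c \<equiv> \<lambda>n \<alpha>. integral {0..1} (\<lambda>\<theta>. B \<alpha> (circ r \<theta>) / circ r \<theta> ^ n)"
  shows "((\<lambda>(n, \<alpha>). c n \<alpha> * z ^ n) has_sum F z) (UNIV \<times> S)"
    and "\<And>n \<alpha>. \<alpha> \<in> S \<Longrightarrow> norm (c n \<alpha> * z ^ n) \<le> m \<alpha> * (norm z / r) ^ n"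
    and "(\<lambda>(n, \<alpha>). m \<alpha> * (norm z / r) ^ n) summable_on (UNIV \<times> S)"
proof -
  have circ_cont: "continuous_on {0..1} (\<lambda>\<theta>. B \<alpha> (circ r \<theta>) / circ r \<theta> ^ n)" for \<alpha> n
    using r by (intro continuous_intros continuous_on_compose2[OF B(1)])
      (auto simp: circ_nonzero)
  have m0: "0 \<le> m \<alpha>" if "\<alpha> \<in> S" for \<alpha>
    using B(2)[OF that, of 0] r by (auto intro: order_trans[OF norm_ge_zero])
  have cb: "norm (c n \<alpha>) \<le> m \<alpha> / r ^ n" if "\<alpha> \<in> S" for n \<alpha>
  proof -
    have "norm (c n \<alpha>) \<le> m \<alpha> / r ^ n * (1 - 0)"
      unfolding c_def
      by (rule integral_bound[OF _ circ_cont])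
        (use r B(2)[OF that] in \<open>auto simp: norm_divide norm_power intro!: divide_right_mono\<close>)
    then show ?thesis by simp
  qed
  show bound: "norm (c n \<alpha> * z ^ n) \<le> m \<alpha> * (norm z / r) ^ n" if "\<alpha> \<in> S" for n \<alpha>
    using mult_right_mono[OF cb[OF that, of n], of "norm z ^ n"]
    by (simp add: norm_mult norm_power power_divide)
  obtain Sm where Sm: "(m has_sum Sm) S" using m by (auto simp: summable_on_def)
  have q: "0 \<le> norm z / r" "norm z / r < 1" using r z by auto
  have "((\<lambda>n. (norm z / r) ^ n) has_sum 1 / (1 - norm z / r)) UNIV"
    by (rule sums_nonneg_imp_has_sum[OF geometric_sums]) (use q in auto)
  then have g: "(\<lambda>n. Sm * (norm z / r) ^ n) summable_on UNIV"
    by (intro summable_on_cmult_right has_sum_imp_summable)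
  show summ: "(\<lambda>(n, \<alpha>). m \<alpha> * (norm z / r) ^ n) summable_on (UNIV \<times> S)"
    by (rule summable_on_SigmaI[OF _ g]) (use q m0 Sm in \<open>auto intro!: has_sum_cmult_left\<close>)
  have "(\<lambda>p. norm (case p of (n, \<alpha>) \<Rightarrow> c n \<alpha> * z ^ n)) summable_on (UNIV \<times> S)"
    by (rule summable_on_comparison_test[OF summ]) (use bound in auto)
  then have sab: "(\<lambda>(n, \<alpha>). c n \<alpha> * z ^ n) summable_on (UNIV \<times> S)"
    by (rule abs_summable_summable)
  define d where "d n = integral {0..1} (\<lambda>\<theta>. F (circ r \<theta>) / circ r \<theta> ^ n)" for n
  have inner: "((\<lambda>\<alpha>. c n \<alpha> * z ^ n) has_sum d n * z ^ n) S" for n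
    unfolding c_def d_def
  proof (rule has_sum_cmult_left, rule has_sum_integral_dominated[where m = "\<lambda>\<alpha>. m \<alpha> / r ^ n"])
    show "(\<lambda>\<alpha>. m \<alpha> / r ^ n) summable_on S"
      using summable_on_cmult_left[OF m, of "1 / r ^ n"] by simp
    show "((\<lambda>\<alpha>. B \<alpha> (circ r \<theta>) / circ r \<theta> ^ n) has_sum F (circ r \<theta>) / circ r \<theta> ^ n) S" for \<theta>
      using has_sum_cmult_left[OF sum[of "circ r \<theta>"], of "1 / circ r \<theta> ^ n"] r by simp
  qed (use r B(2) circ_cont in \<open>auto simp: norm_divide norm_power intro!: divide_right_mono\<close>)
  have d: "d n = (deriv ^^ n) F 0 / fact n" for n
    unfolding d_def by (rule integral_unique[OF Cauchy_coefficient_has_integral[OF F r]])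
  have ball: "z \<in> ball 0 r" using z by simp
  from holomorphic_power_series[OF F(2) ball]
  have sums: "(\<lambda>n. d n * z ^ n) sums F z" by (simp add: d)
  define z' :: complex where "z' = of_real ((norm z + r) / 2)"
  have z': "norm z < norm z'" "norm z' < r"
    using z r norm_ge_zero[of z]
    by (simp_all add: z'_def abs_of_nonneg del: of_real_divide of_real_add norm_ge_zero)
  have "summable (\<lambda>n. d n * z' ^ n)"
    using holomorphic_power_series[OF F(2), of z'] z' by (simp add: d sums_iff)
  then have "summable (\<lambda>n. norm (d n * z ^ n))"
    using z'(1) by (rule powser_insidea)
  then have outer: "((\<lambda>n. d n * z ^ n) has_sum F z) UNIV"
    using sums by (rule norm_summable_imp_has_sum)
  show "((\<lambda>(n, \<alpha>). c n \<alpha> * z ^ n) has_sum F z) (UNIV \<times> S)"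
    by (rule has_sum_SigmaI[OF _ outer sab]) (use inner in auto)
qed

text \<open>
  The coefficients are the iterated Cauchy integrals over the torus \<open>\<bar>u\<bar> = \<bar>v\<bar> = \<bar>w\<bar> = r\<close>. The variables are
  expanded from the last to the first; the variables not yet expanded stay on the closed disc, where
  the bound by the maximum \<open>M\<close> of \<open>f\<close> is uniform.
\<close>

lemma power_series_polydisc:
  fixes f :: "complex \<times> complex \<times> complex \<Rightarrow> complex"
  assumes r: "0 < r" 
    and cont: "continuous_on (cball 0 r \<times> cball 0 r \<times> cball 0 r) f"
    and hol1: "\<And>v w. norm v \<le> r \<Longrightarrow> norm w \<le> r \<Longrightarrow> (\<lambda>u. f (u, v, w)) holomorphic_on ball 0 r"
    and hol2: "\<And>u w. norm u \<le> r \<Longrightarrow> norm w \<le> r \<Longrightarrow> (\<lambda>v. f (u, v, w)) holomorphic_on ball 0 r"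
    and hol3: "\<And>u v. norm u \<le> r \<Longrightarrow> norm v \<le> r \<Longrightarrow> (\<lambda>w. f (u, v, w)) holomorphic_on ball 0 r"
  obtains C where "\<And>x y z. norm x < r \<Longrightarrow> norm y < r \<Longrightarrow> norm z < r \<Longrightarrow>
    ((\<lambda>(i, j, k). C i j k * x ^ i * y ^ j * z ^ k) has_sum f (x, y, z)) UNIV"
proof -
  let ?D = "cball 0 r :: complex set"
  have "compact (f ` (?D \<times> ?D \<times> ?D))"
    by (intro compact_continuous_image[OF cont] compact_Times compact_cball)
  then obtain M where M: "\<And>u v w. norm u \<le> r \<Longrightarrow> norm v \<le> r \<Longrightarrow> norm w \<le> r \<Longrightarrow> norm (f (u, v, w)) \<le> M"
    by (fastforce dest!: compact_imp_bounded simp: bounded_iff)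
  define A3 where "A3 k u v = integral {0..1} (\<lambda>\<theta>. f (u, v, circ r \<theta>) / circ r \<theta> ^ k)" for k :: nat and u v
  define A2 where "A2 j k u = integral {0..1} (\<lambda>\<theta>. A3 k u (circ r \<theta>) / circ r \<theta> ^ j)" for j k :: nat and u
  define A1 where "A1 i j k = integral {0..1} (\<lambda>\<theta>. A2 j k (circ r \<theta>) / circ r \<theta> ^ i)" for i j k :: nat
  have cont3: "continuous_on (?D \<times> ?D) (\<lambda>p. A3 k (fst p) (snd p))" for k
    unfolding A3_def cbox_interval[symmetric]
    by (rule integral_continuous_on_param)
      (use r in \<open>auto simp: split_def circ_nonzero intro!: continuous_intros continuous_on_compose2[OF cont]\<close>)
  have cont3': "continuous_on ?D (A3 k u)" if "norm u \<le> r" for k u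
    using continuous_on_compose2[OF cont3, of ?D "\<lambda>v. (u, v)"] that
    by (simp add: image_subset_iff continuous_intros)
  have cont2: "continuous_on ?D (\<lambda>u. A2 j k u)" for j k
    unfolding A2_def cbox_interval[symmetric]
    using r by (intro integral_continuous_on_param)
      (auto simp: split_def circ_nonzero intro!: continuous_intros
        continuous_on_compose2[OF cont3, of _ "\<lambda>x. (fst x, circ r (snd x))", simplified])
  show ?thesis
  proof (rule that[of A1])
    fix x y z :: complex assume x: "norm x < r" and y: "norm y < r" and z: "norm z < r"
    let ?q = "\<lambda>x. norm (x::complex) / r"
    note conts = continuous_on_compose2[OF cont] 
    have pull: "integral {0..1} (\<lambda>\<theta>. g \<theta> * a / h \<theta>) = integral {0..1} (\<lambda>\<theta>. g \<theta> / h \<theta>) * a"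
      for g h :: "real \<Rightarrow> complex" and a
      by (simp flip: integral_mult_left times_divide_eq_left)
    have sec1: "continuous_on ?D (\<lambda>u. f (u, v, w))"
      and sec2: "continuous_on ?D (\<lambda>u. f (v, u, w))"
      and sec3: "continuous_on ?D (\<lambda>u. f (v, w, u))" if "norm v \<le> r" "norm w \<le> r" for v w
      by (rule conts; use that in \<open>auto intro!: continuous_intros\<close>)+
    \<comment> \<open>The iteration starts from the one-term sum with value f (u, v, w).\<close>
    have s3: "((\<lambda>(k, \<alpha>). A3 k u v * z ^ k) has_sum f (u, v, z)) (UNIV \<times> {()})"
      and b3: "\<And>k. norm (A3 k u v * z ^ k) \<le> M * ?q z ^ k"
      and m3: "(\<lambda>(k, \<alpha>). M * ?q z ^ k) summable_on (UNIV \<times> {()})"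
      if uv: "norm u \<le> r" "norm v \<le> r" for u v
    proof -
      note step = power_expansion_step[where S = "{()}" and m = "\<lambda>_. M" and B = "\<lambda>_ w. f (u, v, w)",
          OF r z sec3[OF uv] hol3[OF uv] sec3[OF uv] M[OF uv] summable_on_finite has_sum_finiteI, simplified, folded A3_def]
      show "((\<lambda>(k, \<alpha>). A3 k u v * z ^ k) has_sum f (u, v, z)) (UNIV \<times> {()})"
        "\<And>k. norm (A3 k u v * z ^ k) \<le> M * ?q z ^ k"
        "(\<lambda>(k, \<alpha>). M * ?q z ^ k) summable_on (UNIV \<times> {()})"
        using step by (simp_all add: split_def)
    qed
    have s2: "((\<lambda>(j, k, \<alpha>). A2 j k u * z ^ k * y ^ j) has_sum f (u, y, z)) (UNIV \<times> UNIV \<times> {()})"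
      and b2: "\<And>j k. norm (A2 j k u * z ^ k * y ^ j) \<le> M * ?q z ^ k * ?q y ^ j"
      and m2: "(\<lambda>(j, k, \<alpha>). M * ?q z ^ k * ?q y ^ j) summable_on (UNIV \<times> UNIV \<times> {()})"
      if u: "norm u \<le> r" for u
    proof -
      have z': "norm z \<le> r" using z by simp
      have c: "continuous_on ?D (case \<alpha> of (k, _) \<Rightarrow> \<lambda>v. A3 k u v * z ^ k)" for \<alpha> :: "nat \<times> unit"
        using cont3'[OF u] by (auto simp: split_def intro!: continuous_intros)
      have b: "norm ((case \<alpha> of (k, _) \<Rightarrow> \<lambda>v. A3 k u v * z ^ k) v) \<le> (case \<alpha> of (k, _) \<Rightarrow> M * ?q z ^ k)"
        if "norm v \<le> r" for v and \<alpha> :: "nat \<times> unit"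
        using b3[OF u that] by (simp add: split_def)
      have s: "((\<lambda>\<alpha>. (case \<alpha> of (k, _) \<Rightarrow> \<lambda>v. A3 k u v * z ^ k) v) has_sum f (u, v, z)) (UNIV \<times> {()})"
        if "norm v \<le> r" for v
        using s3[OF u that] by (simp add: split_def)
      note step = power_expansion_step[OF r y sec2[OF u z'] hol2[OF u z'] c b m3[OF u u] s]
      show "((\<lambda>(j, k, \<alpha>). A2 j k u * z ^ k * y ^ j) has_sum f (u, y, z)) (UNIV \<times> UNIV \<times> {()})"
        using step(1) by (simp add: split_def pull flip: A2_def)
      show "norm (A2 j k u * z ^ k * y ^ j) \<le> M * ?q z ^ k * ?q y ^ j" for j k
        using step(2)[of "(k, ())" j] by (simp add: pull flip: A2_def)
      show "(\<lambda>(j, k, \<alpha>). M * ?q z ^ k * ?q y ^ j) summable_on (UNIV \<times> UNIV \<times> {()})"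
        using step(3) by (simp add: split_def)
    qed
    have s1: "((\<lambda>(i, j, k, \<alpha>). A1 i j k * (z ^ k * y ^ j) * x ^ i) has_sum f (x, y, z)) (UNIV \<times> UNIV \<times> UNIV \<times> {()})"
    proof -
      have yz': "norm y \<le> r" "norm z \<le> r" "norm (0::complex) \<le> r" using y z r by simp_all
      have c: "continuous_on ?D (case \<alpha> of (j, k, _) \<Rightarrow> \<lambda>u. A2 j k u * (z ^ k * y ^ j))" for \<alpha> :: "nat \<times> nat \<times> unit"
        using cont2 by (auto simp: split_def intro!: continuous_intros)
      have b: "norm ((case \<alpha> of (j, k, _) \<Rightarrow> \<lambda>u. A2 j k u * (z ^ k * y ^ j)) v) \<le> (case \<alpha> of (j, k, _) \<Rightarrow> M * ?q z ^ k * ?q y ^ j)"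
        if "norm v \<le> r" for v and \<alpha> :: "nat \<times> nat \<times> unit"
        using b2[OF that] by (simp add: split_def mult.assoc)
      have s: "((\<lambda>\<alpha>. (case \<alpha> of (j, k, _) \<Rightarrow> \<lambda>u. A2 j k u * (z ^ k * y ^ j)) v) has_sum f (v, y, z)) (UNIV \<times> UNIV \<times> {()})"
        if "norm v \<le> r" for v
        using s2[OF that] by (simp add: split_def mult.assoc)
      note step = power_expansion_step(1)[OF r x sec1[OF yz'(1,2)] hol1[OF yz'(1,2)] c b m2[OF yz'(3)] s]
      then show ?thesis by (simp add: split_def pull flip: A1_def)
    qed
    have bij: "bij_betw (\<lambda>(i, j, k). (i, j, k, ())) UNIV (UNIV \<times> UNIV \<times> UNIV \<times> {()})"
      by (auto simp: bij_betw_def inj_on_def image_def)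
    show "((\<lambda>(i, j, k). A1 i j k * x ^ i * y ^ j * z ^ k) has_sum f (x, y, z)) UNIV"
      using s1 unfolding has_sum_reindex_bij_betw[OF bij, symmetric]
      by (simp add: split_def mult_ac)
  qed
qed

section \<open>Complex differentiability on the space of complex triples\<close>

text \<open>
  A function on the real vector space \<open>\<complex>\<^sup>3\<close> is complex differentiable iff its real derivative
  commutes with multiplication by complex scalars. The next two predicates say this for functions into
  \<open>\<complex>\<close> and into \<open>\<complex>\<^sup>3\<close>.
\<close>

definition cscale :: "complex \<Rightarrow> complex \<times> complex \<times> complex \<Rightarrow> complex \<times> complex \<times> complex" where
  "cscale c = (\<lambda>(x, y, z). (c * x, c * y, c * z))"

definition of_real3 :: "real \<times> real \<times> real \<Rightarrow> complex \<times> complex \<times> complex" where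
  "of_real3 = (\<lambda>(x, y, z). (of_real x, of_real y, of_real z))"

definition complex_derivative ::
    "(complex \<times> complex \<times> complex \<Rightarrow> complex) \<Rightarrow> (complex \<times> complex \<times> complex \<Rightarrow> complex) \<Rightarrow>
     complex \<times> complex \<times> complex \<Rightarrow> bool" where
  "complex_derivative f L z \<longleftrightarrow>
     (f has_derivative L) (at z) \<and> (\<forall>c v. L (cscale c v) = c * L v)"

definition complex_derivative3 where
  "complex_derivative3 F L z \<longleftrightarrow>
     (F has_derivative L) (at z) \<and> (\<forall>c v. L (cscale c v) = cscale c (L v))"

lemma bounded_linear_cscale: "bounded_linear (\<lambda>c. cscale c v)"
  unfolding cscale_def split_def
  by (intro bounded_linear_Pair bounded_linear_mult_left)

lemma continuous_on_cscale [continuous_intros]: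
  "continuous_on S f \<Longrightarrow> continuous_on S g \<Longrightarrow> continuous_on S (\<lambda>x. cscale (f x) (g x))"
  unfolding cscale_def split_def by (intro continuous_intros)

lemma norm_cscale: "norm (cscale c v) = norm c * norm v"
proof -
  have "norm (cscale c v) = sqrt ((norm c)\<^sup>2 * ((norm (fst v))\<^sup>2 + ((norm (fst (snd v)))\<^sup>2 + (norm (snd (snd v)))\<^sup>2)))"
    by (simp add: cscale_def split_def norm_Pair norm_mult power_mult_distrib distrib_left)
  also have "\<dots> = norm c * norm v"
    by (cases v) (simp add: real_sqrt_mult norm_Pair)
  finally show ?thesis .
qed

text \<open>
  Restriction to a complex line reduces several variables to one.
\<close>

lemma complex_derivative_along_line:
  assumes "complex_derivative f L (a + cscale w v)"
  shows "((\<lambda>w. f (a + cscale w v)) has_field_derivative L v) (at w)"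
proof -
  have L: "(f has_derivative L) (at (a + cscale w v))" and lin: "\<And>c v. L (cscale c v) = c * L v"
    using assms by (auto simp: complex_derivative_def)
  have "((\<lambda>w. a + cscale w v) has_derivative (\<lambda>w. cscale w v)) (at w)"
    by (auto intro!: derivative_eq_intros bounded_linear_imp_has_derivative bounded_linear_cscale)
  from has_derivative_compose[OF this L] show ?thesis
    by (simp add: has_field_derivative_def lin mult_commute_abs)
qed

lemma holomorphic_along_line:
  assumes "\<And>z. z \<in> W \<Longrightarrow> \<exists>L. complex_derivative f L z"
    and "\<And>w. w \<in> S \<Longrightarrow> a + cscale w v \<in> W"
  shows "(\<lambda>w. f (a + cscale w v)) holomorphic_on S"
  unfolding holomorphic_on_def field_differentiable_def
  using assms complex_derivative_along_line has_field_derivative_at_within by blast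

lemma complex_derivative_imp_continuous_on:
  assumes "\<And>z. z \<in> W \<Longrightarrow> \<exists>L. complex_derivative f L z"
  shows "continuous_on W f"
  using assms unfolding complex_derivative_def
  by (meson continuous_at_imp_continuous_on has_derivative_continuous)

lemma complex_power_series:
  assumes "open W" "a \<in> W"
    and diff: "\<And>z. z \<in> W \<Longrightarrow> \<exists>L. complex_derivative f L z"
  obtains r C where "0 < r" and
    "\<And>x y z. norm x < r \<Longrightarrow> norm y < r \<Longrightarrow> norm z < r \<Longrightarrow>
       ((\<lambda>(i, j, k). C i j k * x ^ i * y ^ j * z ^ k) has_sum f (a + (x, y, z))) UNIV"
proof -
  obtain e where e: "0 < e" "ball a e \<subseteq> W" using assms(1,2) openE by blast
  define r where "r = e / 4"
  have r: "0 < r" using e by (simp add: r_def)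
  have inW: "a + (x, y, z) \<in> W" if "norm x \<le> r" "norm y \<le> r" "norm z \<le> r" for x y z
  proof -
    have "norm (x, y, z) \<le> norm x + (norm y + norm z)"
      by (meson add_left_mono norm_Pair_le order_trans)
    also have "\<dots> < e" using that e by (simp add: r_def)
    finally have "a + (x, y, z) \<in> ball a e"
      using dist_norm[of "a + (x, y, z)" a] unfolding mem_ball
      by (metis add_diff_cancel_left' dist_commute)
    then show ?thesis using e(2) by blast
  qed
  let ?g = "\<lambda>p. f (a + p)"
  note hol = holomorphic_along_line[OF diff, of W "ball 0 r"]
  have con: "continuous_on (cball 0 r \<times> cball 0 r \<times> cball 0 r) ?g"
    using complex_derivative_imp_continuous_on[OF diff]
    by (rule continuous_on_compose2) (auto intro!: continuous_intros inW)
  have hol1: "(\<lambda>u. ?g (u, v, w)) holomorphic_on ball 0 r" if "norm v \<le> r" "norm w \<le> r" for v w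
    using hol[of "a + (0, v, w)" "(1, 0, 0)"] inW that by (simp add: cscale_def add.assoc)
  have hol2: "(\<lambda>v. ?g (u, v, w)) holomorphic_on ball 0 r" if "norm u \<le> r" "norm w \<le> r" for u w
    using hol[of "a + (u, 0, w)" "(0, 1, 0)"] inW that by (simp add: cscale_def add.assoc)
  have hol3: "(\<lambda>w. ?g (u, v, w)) holomorphic_on ball 0 r" if "norm u \<le> r" "norm v \<le> r" for u v
    using hol[of "a + (u, v, 0)" "(0, 0, 1)"] inW that by (simp add: cscale_def add.assoc)
  show ?thesis
    by (rule power_series_polydisc[OF r con hol1 hol2 hol3]; (assumption | rule that[OF r]))
qed

text \<open>
  The Cauchy formula along the complex line through \<open>z\<close> in direction \<open>v\<close> writes the directional
  derivative as an integral of values of \<open>f\<close>. Hence complex differentiability alone gives a continuous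
  derivative, as the inverse function theorem requires.
\<close>

lemma complex_derivative_continuous:
  assumes "open W" and der: "\<And>z. z \<in> W \<Longrightarrow> complex_derivative f (D z) z"
  shows "continuous_on W (\<lambda>z. D z v)"
proof -
  have diff: "\<exists>L. complex_derivative f L z" if "z \<in> W" for z
    by (intro exI[of _ "D z"] der that)
  have "continuous (at a) (\<lambda>z. D z v)" if a: "a \<in> W" for a
  proof -
    obtain e where e: "0 < e" "ball a e \<subseteq> W" using openE[OF \<open>open W\<close> a] by metis
    \<comment> \<open>With this radius, all circles with centre within \<open>e / 2\<close> of \<open>a\<close> stay inside the ball of radius \<open>e\<close>.\<close>
    define r where "r = e / (2 * (1 + norm v))"
    have nv: "0 < 1 + norm v" by (simp add: add_pos_nonneg)
    have r: "0 < r" using e nv by (simp add: r_def)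
    have inW: "z + cscale w v \<in> W" if "z \<in> ball a (e / 2)" "norm w \<le> r" for z w
    proof -
      have "norm w * norm v \<le> r * norm v" using that(2) by (intro mult_right_mono) auto
      also have "\<dots> < r * (1 + norm v)" using r by simp
      also have "\<dots> = e / 2" using nv by (simp add: r_def divide_simps)
      finally have "norm w * norm v < e / 2" .
      moreover have "norm (a - (z + cscale w v)) \<le> norm (a - z) + norm (cscale w v)"
        using norm_triangle_ineq4[of "a - z" "cscale w v"] by (simp add: algebra_simps)
      ultimately have "dist a (z + cscale w v) < e"
        using that(1) by (simp add: dist_norm norm_cscale)
      then show ?thesis using e(2) by auto
    qed
    have Cauchy: "D z v = integral {0..1} (\<lambda>\<theta>. f (z + cscale (circ r \<theta>) v) / circ r \<theta>)"
      if z: "z \<in> ball a (e / 2)" for z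
    proof -
      let ?h = "\<lambda>w. f (z + cscale w v)"
      have hol: "?h holomorphic_on ball 0 r"
        by (rule holomorphic_along_line[OF diff]) (use inW[OF z] in auto)
      have con: "continuous_on (cball 0 r) ?h"
        by (rule continuous_on_compose2[OF complex_derivative_imp_continuous_on[OF diff]])
          (use inW[OF z] in \<open>auto intro!: continuous_intros\<close>)
      have "z + cscale 0 v \<in> W" using inW[OF z, of 0] r by simp
      then have "(?h has_field_derivative D (z + cscale 0 v) v) (at 0)"
        by (intro complex_derivative_along_line der)
      then have "deriv ?h 0 = D z v"
        by (simp add: DERIV_imp_deriv cscale_def split_def zero_prod_def[symmetric])
      then show ?thesis
        using integral_unique[OF Cauchy_coefficient_has_integral[OF con hol r, of 1]] by simp
    qed
    have cont: "continuous_on (ball a (e / 2)) (\<lambda>z. integral {0..1} (\<lambda>\<theta>. f (z + cscale (circ r \<theta>) v) / circ r \<theta>))"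
      unfolding cbox_interval[symmetric]
      by (rule integral_continuous_on_param)
        (use r inW in \<open>auto simp: split_def circ_nonzero intro!: continuous_intros 
          continuous_on_compose2[OF complex_derivative_imp_continuous_on[OF diff]]\<close>)
    have "continuous_on (ball a (e / 2)) (\<lambda>z. D z v)"
      by (rule continuous_on_eq[OF cont]) (simp add: Cauchy)
    then show ?thesis
      using e(1) by (simp add: continuous_on_eq_continuous_at)
  qed
  then show ?thesis by (simp add: continuous_at_imp_continuous_on)
qed

lemma cscale_components [simp]:
  "fst (cscale c v) = c * fst v" "fst (snd (cscale c v)) = c * fst (snd v)"
  "snd (snd (cscale c v)) = c * snd (snd v)"
  by (simp_all add: cscale_def split_def)

lemma complex_derivative3D:
  assumes "complex_derivative3 F L z"
  shows "(F has_derivative L) (at z)" and "L (cscale c v) = cscale c (L v)"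
  using assms unfolding complex_derivative3_def by blast+

lemma complex_derivative_components:
  assumes "complex_derivative3 F L z"
  shows "complex_derivative (\<lambda>z. fst (F z)) (\<lambda>v. fst (L v)) z"
    and "complex_derivative (\<lambda>z. fst (snd (F z))) (\<lambda>v. fst (snd (L v))) z"
    and "complex_derivative (\<lambda>z. snd (snd (F z))) (\<lambda>v. snd (snd (L v))) z"
  using assms unfolding complex_derivative3_def complex_derivative_def
  by (auto intro!: derivative_eq_intros)

lemma complex_derivative3_continuous:
  assumes "open W" and der: "\<And>z. z \<in> W \<Longrightarrow> complex_derivative3 F (D z) z"
  shows "continuous_on W (\<lambda>z. D z v)"
proof -
  note comp = complex_derivative_components[OF der]
  have "continuous_on W (\<lambda>z. (fst (D z v), fst (snd (D z v)), snd (snd (D z v))))"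
    by (intro continuous_on_Pair complex_derivative_continuous[OF \<open>open W\<close> comp(1)]
        complex_derivative_continuous[OF \<open>open W\<close> comp(2)]
        complex_derivative_continuous[OF \<open>open W\<close> comp(3)])
  then show ?thesis by simp
qed

lemma complex_derivative3_compose:
  assumes "complex_derivative3 G L' z" "complex_derivative3 F L (G z)"
  shows "complex_derivative3 (\<lambda>z. F (G z)) (\<lambda>v. L (L' v)) z"
  using assms has_derivative_compose[of G L' z UNIV F L]
  unfolding complex_derivative3_def by (simp del: split_paired_All)

text \<open>
  The real inverse function theorem suffices: the derivative of the inverse is the inverse of
  a complex-linear map, hence complex-linear.
\<close>

lemma complex_local_inverse:
  assumes "open W" "a \<in> W" and der: "\<And>z. z \<in> W \<Longrightarrow> complex_derivative3 F (D z) z"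
    and "inj (D a)"
  obtains U V G where "open U" "U \<subseteq> W" "a \<in> U" "open V" "F a \<in> V" "homeomorphism U V F G"
    "\<And>y. y \<in> V \<Longrightarrow> \<exists>L. complex_derivative3 G L y"
proof -
  have hd: "(F has_derivative D z) (at z)" if "z \<in> W" for z
    using der[OF that] by (simp add: complex_derivative3_def)
  have bl: "bounded_linear (D z)" if "z \<in> W" for z
    using hd[OF that] by (rule has_derivative_bounded_linear)
  define f' where "f' z = Blinfun (D z)" for z
  have f': "blinfun_apply (f' z) = D z" if "z \<in> W" for z
    unfolding f'_def by (rule bounded_linear_Blinfun_apply[OF bl[OF that]])
  have "continuous_on W (\<lambda>z. f' z v)" for v
  proof (rule continuous_on_eq)
    show "continuous_on W (\<lambda>z. D z v)"
      by (rule complex_derivative3_continuous[OF \<open>open W\<close> der])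
    show "D z v = f' z v" if "z \<in> W" for z
      using f'[OF that] by simp
  qed
  then have cont: "continuous_on W f'" by (rule continuous_on_blinfun_componentwise)
  have "linear (D a)" using bl[OF \<open>a \<in> W\<close>] by (rule bounded_linear.linear)
  then obtain g where g: "linear g" "g \<circ> D a = id"
    using linear_injective_left_inverse \<open>inj (D a)\<close> by blast
  have "Blinfun g o\<^sub>L f' a = id_blinfun"
    using g f'[OF \<open>a \<in> W\<close>]
    by (intro blinfun_eqI)
      (simp add: bounded_linear_Blinfun_apply linear_conv_bounded_linear pointfree_idE)
  from inverse_function_theorem[OF \<open>open W\<close> _ cont \<open>a \<in> W\<close> this, of F]
  obtain U V G G' where UV: "open U" "U \<subseteq> W" "a \<in> U" "open V" "F a \<in> V" "homeomorphism U V F G"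
    and G: "\<And>y. y \<in> V \<Longrightarrow> (G has_derivative G' y) (at y)"
    and G': "\<And>y. y \<in> V \<Longrightarrow> G' y = inv (blinfun_apply (f' (G y)))"
      "\<And>y. y \<in> V \<Longrightarrow> bij (blinfun_apply (f' (G y)))"
    using hd f' by metis
  have "complex_derivative3 G (G' y) y" if y: "y \<in> V" for y
    unfolding complex_derivative3_def
  proof (intro conjI allI)
    show "(G has_derivative G' y) (at y)" using G y .
    fix c v
    have GW: "G y \<in> W" using UV(2,6) y by (auto simp: homeomorphism_def)
    have inv: "G' y = inv (D (G y))" and bij: "bij (D (G y))"
      using G'[OF y] f'[OF GW] by auto
    have "D (G y) (cscale c (G' y v)) = cscale c v"
      using bij by (simp add: complex_derivative3D(2)[OF der[OF GW]] inv bij_is_surj surj_f_inv_f)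
    then show "G' y (cscale c v) = cscale c (G' y v)"
      using bij by (metis inv bij_inv_eq_iff)
  qed
  then show ?thesis using UV that by blast
qed

section \<open>Real-analytic transition maps\<close>

text \<open>
  Multi-indices on the standard basis of \<open>\<real>\<^sup>3\<close> are triples of exponents.
\<close>

lemma real_analytic_onI:
  fixes h :: "real \<times> real \<times> real \<Rightarrow> real \<times> real \<times> real"
  assumes "\<And>a. a \<in> S \<Longrightarrow> \<exists>r>0. \<exists>C. \<forall>x y z. \<bar>x\<bar> < r \<longrightarrow> \<bar>y\<bar> < r \<longrightarrow> \<bar>z\<bar> < r \<longrightarrow>
     ((\<lambda>(i, j, k). (x ^ i * y ^ j * z ^ k) *\<^sub>R C i j k) has_sum h (a + (x, y, z))) UNIV"
  shows "real_analytic_on h S"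
  unfolding real_analytic_on_def
proof
  fix a assume "a \<in> S"
  then obtain r C where r: "0 < r" and C: "\<And>x y z. \<bar>x\<bar> < r \<Longrightarrow> \<bar>y\<bar> < r \<Longrightarrow> \<bar>z\<bar> < r \<Longrightarrow>
     ((\<lambda>(i, j, k). (x ^ i * y ^ j * z ^ k) *\<^sub>R C i j k) has_sum h (a + (x, y, z))) UNIV"
    using assms by meson
  define b1 b2 b3 :: "real \<times> real \<times> real" where b: "b1 = (1, 0, 0)" "b2 = (0, 1, 0)" "b3 = (0, 0, 1)"
  have Basis: "Basis = {b1, b2, b3}" and ne: "b1 \<noteq> b2" "b1 \<noteq> b3" "b2 \<noteq> b3"
    by (auto simp: b Basis_prod_def zero_prod_def)
  let ?g = "\<lambda>\<alpha>::real \<times> real \<times> real \<Rightarrow> nat. (\<alpha> b1, \<alpha> b2, \<alpha> b3)"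
  have bij: "bij_betw ?g (Basis \<rightarrow>\<^sub>E UNIV) UNIV"
  proof (rule bij_betw_byWitness[where f' = "\<lambda>(i, j, k). restrict (\<lambda>b. if b = b1 then i else if b = b2 then j else k) Basis"])
    show "\<forall>\<alpha>\<in>Basis \<rightarrow>\<^sub>E UNIV. (case ?g \<alpha> of (i, j, k) \<Rightarrow>
        restrict (\<lambda>b. if b = b1 then i else if b = b2 then j else k) Basis) = \<alpha>"
      by (auto simp: Basis fun_eq_iff PiE_def extensional_def)
    show "\<forall>p\<in>UNIV. ?g (case p of (i, j, k) \<Rightarrow>
        restrict (\<lambda>b. if b = b1 then i else if b = b2 then j else k) Basis) = p"
      using ne by (auto simp: Basis)
    show "(\<lambda>(i, j, k). restrict (\<lambda>b. if b = b1 then i else if b = b2 then j else k) Basis) ` UNIV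
        \<subseteq> Basis \<rightarrow>\<^sub>E UNIV"
      by (intro image_subsetI) (simp add: split_def restrict_PiE_iff)
  qed simp
  show "\<exists>r>0. \<exists>C. \<forall>x\<in>ball a r.
      ((\<lambda>\<alpha>. (\<Prod>b\<in>Basis. ((x - a) \<bullet> b) ^ \<alpha> b) *\<^sub>R C \<alpha>) has_sum h x) (Basis \<rightarrow>\<^sub>E UNIV)"
  proof (intro exI[of _ r] conjI r exI[of _ "\<lambda>\<alpha>. case ?g \<alpha> of (i, j, k) \<Rightarrow> C i j k"] ballI)
    fix p assume p: "p \<in> ball a r"
    obtain x y z where xyz: "p - a = (x, y, z)" by (cases "p - a")
    have n: "norm (x, y, z) < r" using p unfolding xyz[symmetric] by (simp add: dist_norm norm_minus_commute)
    have "\<bar>x\<bar> \<le> norm (x, y, z)" "norm (y, z) \<le> norm (x, y, z)" "\<bar>y\<bar> \<le> norm (y, z)" "\<bar>z\<bar> \<le> norm (y, z)"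
      by (auto simp: norm_Pair intro!: real_le_rsqrt)
    then have "((\<lambda>(i, j, k). (x ^ i * y ^ j * z ^ k) *\<^sub>R C i j k) has_sum h (a + (x, y, z))) UNIV"
      using n by (intro C) linarith+
    moreover have "a + (x, y, z) = p" by (simp flip: xyz)
    ultimately have "((\<lambda>\<alpha>. (x ^ \<alpha> b1 * y ^ \<alpha> b2 * z ^ \<alpha> b3) *\<^sub>R C (\<alpha> b1) (\<alpha> b2) (\<alpha> b3)) has_sum h p)
        (Basis \<rightarrow>\<^sub>E UNIV)"
      by (subst (asm) has_sum_reindex_bij_betw[OF bij, symmetric]) simp
    then show "((\<lambda>\<alpha>. (\<Prod>b\<in>Basis. ((p - a) \<bullet> b) ^ \<alpha> b) *\<^sub>R (case ?g \<alpha> of (i, j, k) \<Rightarrow> C i j k)) has_sum h p) (Basis \<rightarrow>\<^sub>E UNIV)"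
      unfolding xyz Basis using ne by (simp add: b mult.assoc)
  qed
qed

lemma real_part_of_power_series:
  assumes "((\<lambda>(i, j, k). C i j k * of_real x ^ i * of_real y ^ j * of_real z ^ k) has_sum s) UNIV"
  shows "((\<lambda>(i, j, k). (x ^ i * y ^ j * z ^ k) *\<^sub>R Re (C i j k)) has_sum Re s) UNIV"
proof -
  have "Re (C i j k * of_real x ^ i * of_real y ^ j * of_real z ^ k) = (x ^ i * y ^ j * z ^ k) *\<^sub>R Re (C i j k)" for i j k
  proof -
    have "C i j k * of_real x ^ i * of_real y ^ j * of_real z ^ k = (x ^ i * y ^ j * z ^ k) *\<^sub>R C i j k"
      by (simp add: scaleR_conv_of_real mult_ac)
    then show ?thesis by simp
  qed
  then have "(\<lambda>p. Re (case p of (i, j, k) \<Rightarrow> C i j k * of_real x ^ i * of_real y ^ j * of_real z ^ k))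
      = (\<lambda>(i, j, k). (x ^ i * y ^ j * z ^ k) *\<^sub>R Re (C i j k))"
    by (simp only: fun_eq_iff split_paired_All prod.case) simp
  then show ?thesis using has_sum_Re[OF assms] by (simp only:)
qed

text \<open>
  If \<open>Q\<close> is injective and both \<open>P\<close> and \<open>Q\<close> extend complex-differentiably, with injective derivative of the
  extension of \<open>Q\<close>, then \<open>h = P \<circ> Q\<^sup>-\<^sup>1\<close> is the restriction to real points of a complex-differentiable map.
  The local inverse \<open>G\<close> of the complexified \<open>Q\<close> could send a real point to a non-real one. It does
  not: by invariance of domain \<open>Q\<close> maps real neighbourhoods onto real neighbourhoods, so every real
  point near \<open>Q u\<close> has a real preimage in the domain on which \<open>G\<close> inverts.
\<close>

lemma real_analytic_transition:
  fixes P Q h :: "real \<times> real \<times> real \<Rightarrow> real \<times> real \<times> real"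
  assumes U: "open U" "inj_on Q U" and h: "\<And>u. u \<in> U \<Longrightarrow> h (Q u) = P u"
    and W: "open W" "\<And>u. u \<in> U \<Longrightarrow> of_real3 u \<in> W"
    and Pc: "\<And>w. w \<in> W \<Longrightarrow> \<exists>L. complex_derivative3 Pc L w"
    and Qc: "\<And>w. w \<in> W \<Longrightarrow> complex_derivative3 Qc (D w) w"
    and real: "\<And>u. u \<in> U \<Longrightarrow> Pc (of_real3 u) = of_real3 (P u)"
      "\<And>u. u \<in> U \<Longrightarrow> Qc (of_real3 u) = of_real3 (Q u)"
    and inj: "\<And>u. u \<in> U \<Longrightarrow> inj (D (of_real3 u))"
  shows "real_analytic_on h (Q ` U)" "open (Q ` U)"
proof -
  define re3 :: "complex \<times> complex \<times> complex \<Rightarrow> real \<times> real \<times> real"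
    where "re3 = (\<lambda>(x, y, z). (Re x, Re y, Re z))"
  have re3: "re3 (of_real3 u) = u" for u by (simp add: re3_def of_real3_def split_def)
  have cont_ir: "continuous_on A of_real3" "continuous_on B re3" for A B
    unfolding of_real3_def re3_def split_def by (intro continuous_intros)+
  have "continuous_on W Qc"
    using Qc unfolding complex_derivative3_def
    by (meson continuous_at_imp_continuous_on has_derivative_continuous)
  then have "continuous_on U (\<lambda>u. Qc (of_real3 u))"
    by (rule continuous_on_compose2[OF _ cont_ir(1)]) (use W in \<open>simp add: image_subset_iff\<close>)
  then have "continuous_on U (\<lambda>u. re3 (Qc (of_real3 u)))"
    by (rule continuous_on_compose2[OF cont_ir(2)[of UNIV] _ subset_UNIV])
  then have contQ: "continuous_on U Q"
    by (rule continuous_on_eq) (simp add: real re3)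
  show "open (Q ` U)"
    by (rule invariance_of_domain[OF contQ U])
  show "real_analytic_on h (Q ` U)"
  proof (rule real_analytic_onI)
    fix q assume "q \<in> Q ` U"
    then obtain u where u: "u \<in> U" "q = Q u" by auto
    obtain U' V G where U': "open U'" "U' \<subseteq> W" "of_real3 u \<in> U'" and V: "open V" "Qc (of_real3 u) \<in> V"
      and hom: "homeomorphism U' V Qc G" and G: "\<And>y. y \<in> V \<Longrightarrow> \<exists>L. complex_derivative3 G L y"
      using complex_local_inverse[OF W(1) W(2)[OF u(1)] Qc inj[OF u(1)]] by metis
    define F where "F y = Pc (G y)" for y
    have F: "\<exists>L. complex_derivative3 F L y" if "y \<in> V" for y
    proof -
      have "G y \<in> W" using hom that U'(2) by (auto simp: homeomorphism_def)
      then show ?thesis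
        using Pc G[OF that] complex_derivative3_compose unfolding F_def by blast
    qed
    have Vq: "of_real3 q \<in> V" using V(2) u real by simp
    have F1: "\<exists>L. complex_derivative (\<lambda>y. fst (F y)) L y"
      and F2: "\<exists>L. complex_derivative (\<lambda>y. fst (snd (F y))) L y"
      and F3: "\<exists>L. complex_derivative (\<lambda>y. snd (snd (F y))) L y" if "y \<in> V" for y
      using F[OF that] complex_derivative_components by blast+
    obtain r1 C1 where r1: "0 < r1" "\<And>x y z. norm x < r1 \<Longrightarrow> norm y < r1 \<Longrightarrow> norm z < r1 \<Longrightarrow>
       ((\<lambda>(i, j, k). C1 i j k * x ^ i * y ^ j * z ^ k) has_sum fst (F (of_real3 q + (x, y, z)))) UNIV"
      by (rule complex_power_series[OF V(1) Vq F1], assumption) (rule that)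
    obtain r2 C2 where r2: "0 < r2" "\<And>x y z. norm x < r2 \<Longrightarrow> norm y < r2 \<Longrightarrow> norm z < r2 \<Longrightarrow>
       ((\<lambda>(i, j, k). C2 i j k * x ^ i * y ^ j * z ^ k) has_sum fst (snd (F (of_real3 q + (x, y, z))))) UNIV"
      by (rule complex_power_series[OF V(1) Vq F2], assumption) (rule that)
    obtain r3 C3 where r3: "0 < r3" "\<And>x y z. norm x < r3 \<Longrightarrow> norm y < r3 \<Longrightarrow> norm z < r3 \<Longrightarrow>
       ((\<lambda>(i, j, k). C3 i j k * x ^ i * y ^ j * z ^ k) has_sum snd (snd (F (of_real3 q + (x, y, z))))) UNIV"
      by (rule complex_power_series[OF V(1) Vq F3], assumption) (rule that)
    define U0 where "U0 = U \<inter> of_real3 -` U'"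
    have "open (of_real3 -` U')"
      using cont_ir(1)[of UNIV] U'(1) by (simp add: continuous_on_open_vimage open_vimage)
    then have oU0: "open U0" unfolding U0_def using U(1) by (rule open_Int[rotated])
    have "open (Q ` U0)"
      by (rule invariance_of_domain[OF continuous_on_subset[OF contQ] oU0 inj_on_subset[OF U(2)]])
        (auto simp: U0_def)
    moreover have "q \<in> Q ` U0" using u U'(3) by (auto simp: U0_def)
    ultimately obtain e where e: "0 < e" "ball q e \<subseteq> Q ` U0"
      using openE by metis
    have Fh: "F (of_real3 v) = of_real3 (h v)" if v: "v \<in> ball q e" for v
    proof -
      obtain w where w: "w \<in> U" "of_real3 w \<in> U'" "v = Q w" using subsetD[OF e(2) v] unfolding U0_def by blast
      then have "G (of_real3 v) = of_real3 w"
        using hom real(2)[OF w(1)] by (auto simp: homeomorphism_def)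
      then show ?thesis using w real(1)[OF w(1)] h[OF w(1)] by (simp add: F_def)
    qed
    define r where "r = min (e / 4) (min r1 (min r2 r3))"
    show "\<exists>r>0. \<exists>C. \<forall>x y z. \<bar>x\<bar> < r \<longrightarrow> \<bar>y\<bar> < r \<longrightarrow> \<bar>z\<bar> < r \<longrightarrow>
     ((\<lambda>(i, j, k). (x ^ i * y ^ j * z ^ k) *\<^sub>R C i j k) has_sum h (q + (x, y, z))) UNIV"
    proof (intro exI[of _ r] conjI exI[of _ "\<lambda>i j k. (Re (C1 i j k), Re (C2 i j k), Re (C3 i j k))"] allI impI)
      show "0 < r" using r1 r2 r3 e by (simp add: r_def)
      fix x y z assume xyz: "\<bar>x\<bar> < r" "\<bar>y\<bar> < r" "\<bar>z\<bar> < r"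
      define hv where "hv = h (q + (x, y, z))"
      have "norm (x, y, z) \<le> \<bar>x\<bar> + (\<bar>y\<bar> + \<bar>z\<bar>)"
        by (metis add_left_mono norm_Pair_le order_trans real_norm_def)
      also have "\<dots> < e" using xyz e by (simp add: r_def)
      finally have "q + (x, y, z) \<in> ball q e"
        using dist_norm[of "q + (x, y, z)" q] unfolding mem_ball
        by (metis add_diff_cancel_left' dist_commute)
      moreover have "of_real3 (q + (x, y, z)) = of_real3 q + (of_real x, of_real y, of_real z)"
        by (cases q) (simp add: of_real3_def)
      ultimately have Feq: "F (of_real3 q + (of_real x, of_real y, of_real z)) = of_real3 hv"
        using Fh[of "q + (x, y, z)"] by (simp add: hv_def)
      have Re_of_real3: "Re (fst (of_real3 p)) = fst p" "Re (fst (snd (of_real3 p))) = fst (snd p)"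
        "Re (snd (snd (of_real3 p))) = snd (snd p)" for p
        by (simp_all add: of_real3_def split_def)
      let ?m = "\<lambda>i j k. x ^ i * y ^ j * z ^ k"
      have s1: "((\<lambda>(i, j, k). ?m i j k *\<^sub>R Re (C1 i j k)) has_sum fst hv) UNIV"
        by (rule real_part_of_power_series[OF r1(2)[of "of_real x" "of_real y" "of_real z"],
              unfolded Feq Re_of_real3])
          (use xyz in \<open>simp_all add: r_def\<close>)
      have s2: "((\<lambda>(i, j, k). ?m i j k *\<^sub>R Re (C2 i j k)) has_sum fst (snd hv)) UNIV"
        by (rule real_part_of_power_series[OF r2(2)[of "of_real x" "of_real y" "of_real z"],
              unfolded Feq Re_of_real3])
          (use xyz in \<open>simp_all add: r_def\<close>)
      have s3: "((\<lambda>(i, j, k). ?m i j k *\<^sub>R Re (C3 i j k)) has_sum snd (snd hv)) UNIV"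
        by (rule real_part_of_power_series[OF r3(2)[of "of_real x" "of_real y" "of_real z"],
              unfolded Feq Re_of_real3])
          (use xyz in \<open>simp_all add: r_def\<close>)
      have bl: "bounded_linear (\<lambda>t::real. (t, 0::real, 0::real))" "bounded_linear (\<lambda>t::real. (0::real, t, 0::real))"
        "bounded_linear (\<lambda>t::real. (0::real, 0::real, t))"
        by (intro bounded_linear_Pair bounded_linear_ident bounded_linear_zero)+
      show "((\<lambda>(i, j, k). ?m i j k *\<^sub>R (Re (C1 i j k), Re (C2 i j k), Re (C3 i j k))) has_sum h (q + (x, y, z))) UNIV"
        using has_sum_add[OF has_sum_bounded_linear[OF bl(1) s1]
            has_sum_add[OF has_sum_bounded_linear[OF bl(2) s2] has_sum_bounded_linear[OF bl(3) s3]]]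
        unfolding hv_def[symmetric] by (cases hv) (simp add: split_def)
    qed
  qed
qed

section \<open>Moments of a kernel along quadratics\<close>

text \<open>
  Defined over the reals and the complex numbers at once, because the same formulas are needed for the
  charts and for their complexifications.
\<close>

definition moment :: "('a \<Rightarrow> 'a) \<Rightarrow> nat \<Rightarrow> 'a \<Rightarrow> 'a \<Rightarrow> 'a::{banach, real_normed_field}" where
  "moment \<kappa> m s b = integral {0..1} (\<lambda>\<eta>. of_real \<eta> ^ m * \<kappa> (s + b * (of_real \<eta>)\<^sup>2))"

lemma moment_integrand_continuous:
  fixes \<kappa> :: "'a \<Rightarrow> 'a::{banach, real_normed_field}"
  assumes "continuous_on S \<kappa>" "\<And>\<eta>. \<eta> \<in> {0..1} \<Longrightarrow> s + b * (of_real \<eta>)\<^sup>2 \<in> S"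
  shows "continuous_on {0..1} (\<lambda>\<eta>::real. of_real \<eta> ^ m * \<kappa> (s + b * (of_real \<eta>)\<^sup>2))"
  by (intro continuous_intros continuous_on_compose2[OF assms(1)]) (use assms(2) in auto)

text \<open>
  Differentiation under the integral sign; differentiating in \<open>b\<close> brings down a factor \<open>\<eta>\<^sup>2\<close> and so raises
  the order of the moment by two.
\<close>

lemma moment_has_derivative:
  fixes \<kappa> :: "'a \<Rightarrow> 'a::{banach, real_normed_field}"
  assumes U: "open U" "p \<in> U"
    and US: "\<And>s b \<eta>. (s, b) \<in> U \<Longrightarrow> \<eta> \<in> {0..1} \<Longrightarrow> s + b * (of_real \<eta>)\<^sup>2 \<in> S"
    and der: "\<And>v. v \<in> S \<Longrightarrow> (\<kappa> has_field_derivative \<kappa>' v) (at v)"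
    and cont: "continuous_on S \<kappa>'"
  shows "((\<lambda>p. moment \<kappa> m (fst p) (snd p)) has_derivative
     (\<lambda>d. moment \<kappa>' m (fst p) (snd p) * fst d + moment \<kappa>' (m + 2) (fst p) (snd p) * snd d)) (at p)"
proof -
  obtain e where e: "0 < e" "ball p e \<subseteq> U" using openE[OF U] by metis
  let ?B = "ball p e"
  have BS: "fst q + snd q * (of_real \<eta>)\<^sup>2 \<in> S" if "q \<in> ?B" "\<eta> \<in> {0..1}" for q \<eta>
    using US[of "fst q" "snd q" \<eta>] that e(2) by auto
  have contk: "continuous_on S \<kappa>"
    using der by (meson DERIV_isCont continuous_at_imp_continuous_on)
  define w where "w q \<eta> = of_real \<eta> ^ m * \<kappa>' (fst q + snd q * (of_real \<eta>)\<^sup>2)" for q :: "'a \<times> 'a" and \<eta> :: real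
  define D where "D q \<eta> = (blinfun_mult_right (w q \<eta>) o\<^sub>L fst_blinfun)
      + (blinfun_mult_right (w q \<eta> * (of_real \<eta>)\<^sup>2) o\<^sub>L snd_blinfun)" for q \<eta>
  have wc: "continuous_on (?B \<times> {0..1}) (\<lambda>x. w (fst x) (snd x))"
    unfolding w_def
    by (intro continuous_intros continuous_on_compose2[OF cont]) (use BS in auto)
  have Dc: "continuous_on (?B \<times> {0..1}) (\<lambda>x. D (fst x) (snd x))"
    unfolding D_def by (intro continuous_intros wc)
  have hd: "((\<lambda>q. integral (cbox 0 1) (\<lambda>\<eta>. of_real \<eta> ^ m * \<kappa> (fst q + snd q * (of_real \<eta>)\<^sup>2))) has_derivative
      blinfun_apply (integral (cbox 0 1) (D p))) (at p within ?B)"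
  proof (rule leibniz_rule[where fx = D])
    fix q and \<eta> :: real assume q: "q \<in> ?B" and \<eta>: "\<eta> \<in> cbox 0 1"
    have "(\<kappa> has_derivative (*) (\<kappa>' (fst q + snd q * (of_real \<eta>)\<^sup>2))) (at (fst q + snd q * (of_real \<eta>)\<^sup>2))"
      using der[OF BS[OF q]] \<eta> by (simp add: has_field_derivative_def)
    then have "((\<lambda>q. \<kappa> (fst q + snd q * (of_real \<eta>)\<^sup>2)) has_derivative
        (\<lambda>d. \<kappa>' (fst q + snd q * (of_real \<eta>)\<^sup>2) * (fst d + snd d * (of_real \<eta>)\<^sup>2))) (at q within ?B)"
      by (rule has_derivative_compose[rotated]) (auto intro!: derivative_eq_intros)
    then have "((\<lambda>q. of_real \<eta> ^ m * \<kappa> (fst q + snd q * (of_real \<eta>)\<^sup>2)) has_derivative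
        (\<lambda>d. of_real \<eta> ^ m * (\<kappa>' (fst q + snd q * (of_real \<eta>)\<^sup>2) * (fst d + snd d * (of_real \<eta>)\<^sup>2)))) (at q within ?B)"
      by (rule has_derivative_mult_right)
    moreover have "(\<lambda>d. of_real \<eta> ^ m * (\<kappa>' (fst q + snd q * (of_real \<eta>)\<^sup>2) * (fst d + snd d * (of_real \<eta>)\<^sup>2)))
      = blinfun_apply (D q \<eta>)"
      by (simp add: fun_eq_iff D_def w_def blinfun.bilinear_simps algebra_simps)
    ultimately show "((\<lambda>q. of_real \<eta> ^ m * \<kappa> (fst q + snd q * (of_real \<eta>)\<^sup>2)) has_derivative
        blinfun_apply (D q \<eta>)) (at q within ?B)" by simp
  next
    fix q assume "q \<in> ?B"
    then show "(\<lambda>\<eta>. of_real \<eta> ^ m * \<kappa> (fst q + snd q * (of_real \<eta>)\<^sup>2)) integrable_on cbox 0 1"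
      unfolding cbox_interval
      by (intro integrable_continuous_interval moment_integrand_continuous[OF contk] BS)
  next
    show "continuous_on (?B \<times> cbox 0 1) (\<lambda>(x, t). D x t)"
      using Dc by (simp add: split_def)
  qed (use e in auto)
  have ap: "blinfun_apply (integral (cbox 0 1) (D p)) d =
      moment \<kappa>' m (fst p) (snd p) * fst d + moment \<kappa>' (m + 2) (fst p) (snd p) * snd d" for d
  proof -
    have pB: "p \<in> ?B" using e by simp
    have wp: "continuous_on {0..1} (w p)"
      unfolding w_def using BS[OF pB] by (intro moment_integrand_continuous[OF cont])
    have Dp: "continuous_on {0..1} (D p)"
      unfolding D_def by (intro continuous_intros wp)
    have "blinfun_apply (integral (cbox 0 1) (D p)) d = integral {0..1} (\<lambda>\<eta>. blinfun_apply (D p \<eta>) d)"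
      using blinfun_apply_integral[OF integrable_continuous_interval[OF Dp]] by (simp add: cbox_interval)
    also have "\<dots> = integral {0..1} (\<lambda>\<eta>. w p \<eta> * fst d + w p \<eta> * (of_real \<eta>)\<^sup>2 * snd d)"
      by (simp add: D_def blinfun.bilinear_simps)
    also have "\<dots> = integral {0..1} (\<lambda>\<eta>. w p \<eta> * fst d) + integral {0..1} (\<lambda>\<eta>. w p \<eta> * (of_real \<eta>)\<^sup>2 * snd d)"
      by (intro Henstock_Kurzweil_Integration.integral_add integrable_continuous_interval continuous_intros wp)
    also have "\<dots> = integral {0..1} (w p) * fst d + integral {0..1} (\<lambda>\<eta>. w p \<eta> * (of_real \<eta>)\<^sup>2) * snd d"
      by simp
    also have "integral {0..1} (w p) = moment \<kappa>' m (fst p) (snd p)"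
      by (simp add: moment_def w_def[abs_def])
    also have "integral {0..1} (\<lambda>\<eta>. w p \<eta> * (of_real \<eta>)\<^sup>2) = moment \<kappa>' (m + 2) (fst p) (snd p)"
      unfolding moment_def by (intro integral_cong) (simp add: w_def power_add power2_eq_square mult_ac)
    finally show ?thesis .
  qed
  have "((\<lambda>p. moment \<kappa> m (fst p) (snd p)) has_derivative
     (\<lambda>d. moment \<kappa>' m (fst p) (snd p) * fst d + moment \<kappa>' (m + 2) (fst p) (snd p) * snd d)) (at p within ?B)"
    by (rule has_derivative_eq_rhs[OF hd[unfolded cbox_interval, folded moment_def] ext])
      (rule ap[unfolded cbox_interval])
  then show ?thesis
    using e(1) by (simp add: at_within_open[of p ?B])
qed

lemma moment_of_real:
  fixes \<kappa>c :: "'a \<Rightarrow> 'a::{banach, real_normed_field}"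
  assumes "\<And>v. \<kappa>c (of_real v) = of_real (\<kappa> v)" "continuous_on UNIV \<kappa>"
  shows "moment \<kappa>c m (of_real s) (of_real b) = of_real (moment \<kappa> m s b)"
proof -
  have "((\<lambda>\<eta>. of_real \<eta> ^ m * \<kappa> (s + b * (of_real \<eta>)\<^sup>2)) has_integral moment \<kappa> m s b) {0..1}"
    unfolding moment_def
    by (intro integrable_integral integrable_continuous_interval moment_integrand_continuous[OF assms(2)]) auto
  then have "((\<lambda>\<eta>. of_real (of_real \<eta> ^ m * \<kappa> (s + b * (of_real \<eta>)\<^sup>2)) :: 'a) has_integral of_real (moment \<kappa> m s b)) {0..1}"
    by (rule has_integral_of_real)
  then show ?thesis
    unfolding moment_def[of \<kappa>c] by (intro integral_unique) (simp add: assms(1) flip: of_real_add of_real_mult of_real_power)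
qed

lemma moment_pos:
  fixes s b :: real
  assumes "continuous_on UNIV \<kappa>" "\<And>v. 0 < \<kappa> v"
  shows "0 < moment \<kappa> m s b"
proof -
  let ?f = "\<lambda>\<eta>. of_real \<eta> ^ m * \<kappa> (s + b * (of_real \<eta>)\<^sup>2)"
  have c: "continuous_on {0..1} ?f" by (rule moment_integrand_continuous[OF assms(1)]) auto
  have nn: "0 \<le> ?f \<eta>" if "\<eta> \<in> {0..1}" for \<eta> using that assms(2) by (simp add: less_imp_le)
  have "integral {0..1} ?f \<noteq> 0"
  proof
    assume "integral {0..1} ?f = 0"
    then have "\<forall>\<eta>\<in>{0..1}. ?f \<eta> = 0" using integral_eq_0_iff[OF c zero_less_one nn] by blast
    then have "?f 1 = 0" by (rule bspec) simp
    then show False using assms(2)[of "s + b"] by simp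
  qed
  moreover have "0 \<le> integral {0..1} ?f" by (rule integral_nonneg) (use c nn in \<open>auto intro: integrable_continuous_interval\<close>)
  ultimately show ?thesis unfolding moment_def by linarith
qed

lemma moment_integral_sum:
  fixes s b :: real
  assumes "continuous_on UNIV \<kappa>" and n: "n = m + 2"
  shows "integral {0..1} (\<lambda>\<eta>. (A + B * \<eta>\<^sup>2) * (\<eta> ^ m * \<kappa> (s + b * \<eta>\<^sup>2))) = A * moment \<kappa> m s b + B * moment \<kappa> n s b"
proof -
  have c: "continuous_on {0..1} (\<lambda>\<eta>. \<eta> ^ m * \<kappa> (s + b * \<eta>\<^sup>2))" for m
    using moment_integrand_continuous[OF assms(1), of s b m] by simp
  have "integral {0..1} (\<lambda>\<eta>. (A + B * \<eta>\<^sup>2) * (\<eta> ^ m * \<kappa> (s + b * \<eta>\<^sup>2)))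
     = integral {0..1} (\<lambda>\<eta>. A * (\<eta> ^ m * \<kappa> (s + b * \<eta>\<^sup>2)) + B * (\<eta> ^ n * \<kappa> (s + b * \<eta>\<^sup>2)))"
    by (intro integral_cong) (simp add: n algebra_simps power2_eq_square)
  also have "\<dots> = integral {0..1} (\<lambda>\<eta>. A * (\<eta> ^ m * \<kappa> (s + b * \<eta>\<^sup>2))) + integral {0..1} (\<lambda>\<eta>. B * (\<eta> ^ n * \<kappa> (s + b * \<eta>\<^sup>2)))"
    by (intro Henstock_Kurzweil_Integration.integral_add integrable_continuous_interval continuous_on_mult_left c)
  also have "\<dots> = A * moment \<kappa> m s b + B * moment \<kappa> n s b"
    by (simp add: moment_def)
  finally show ?thesis .
qed

text \<open>
  The strict Cauchy-Schwarz inequality for \<open>1\<close> and \<open>\<eta>\<^sup>2\<close> with weight \<open>\<kappa>(s + b \<eta>\<^sup>2)\<close>. It says that the Hessian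
  of the convex function behind the endpoint map is positive definite.
\<close>

lemma moment_determinant_pos:
  fixes s b :: real
  assumes "continuous_on UNIV \<kappa>" "\<And>v. 0 < \<kappa> v"
  shows "(moment \<kappa> 2 s b)\<^sup>2 < moment \<kappa> 0 s b * moment \<kappa> 4 s b"
proof -
  \<comment> \<open>The quadratic \<open>A + B \<eta>\<^sup>2\<close> is \<open>B\<close> times the part of \<open>\<eta>\<^sup>2\<close> orthogonal to the constants.\<close>
  define A B where "A = - moment \<kappa> 2 s b" and "B = moment \<kappa> 0 s b"
  let ?g = "\<lambda>\<eta>. (A + B * \<eta>\<^sup>2)\<^sup>2 * \<kappa> (s + b * \<eta>\<^sup>2)"
  have c: "continuous_on {0..1} (\<lambda>\<eta>. \<kappa> (s + b * \<eta>\<^sup>2))"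
    using moment_integrand_continuous[OF assms(1), of s b 0] by simp
  have cg: "continuous_on {0..1} ?g" by (intro continuous_intros c)
  have B: "0 < B" unfolding B_def by (rule moment_pos[OF assms])
  have "integral {0..1} ?g \<noteq> 0"
  proof
    assume "integral {0..1} ?g = 0"
    then have z: "?g \<eta> = 0" if "\<eta> \<in> {0..1}" for \<eta>
      using integral_eq_0_iff[OF cg] assms(2) that by (simp add: less_imp_le)
    show False using z[of 0] z[of 1] assms(2)[of s] assms(2)[of "s + b"] B by simp
  qed
  moreover have "0 \<le> integral {0..1} ?g"
    by (rule integral_nonneg) (use cg assms(2) in \<open>auto intro: integrable_continuous_interval simp: less_imp_le\<close>)
  ultimately have "0 < integral {0..1} ?g" by linarith
  also have "integral {0..1} ?g = integral {0..1} (\<lambda>\<eta>. A * ((A + B * \<eta>\<^sup>2) * (\<eta> ^ 0 * \<kappa> (s + b * \<eta>\<^sup>2))) + B * ((A + B * \<eta>\<^sup>2) * (\<eta> ^ 2 * \<kappa> (s + b * \<eta>\<^sup>2))))"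
    by (intro integral_cong) (simp add: algebra_simps power2_eq_square)
  also have "\<dots> = A * (A * moment \<kappa> 0 s b + B * moment \<kappa> 2 s b) + B * (A * moment \<kappa> 2 s b + B * moment \<kappa> 4 s b)"
    by (subst Henstock_Kurzweil_Integration.integral_add)
      (auto intro!: integrable_continuous_interval continuous_intros c 
        simp: moment_integral_sum[OF assms(1), where m = 0 and n = 2, simplified] moment_integral_sum[OF assms(1), where m = 2 and n = 4])
  also have "\<dots> = B * (B * moment \<kappa> 4 s b - (moment \<kappa> 2 s b)\<^sup>2)"
    unfolding A_def B_def by (simp add: algebra_simps power2_eq_square)
  finally show ?thesis using B by (simp add: zero_less_mult_iff B_def)
qed

text \<open>
  Integration of the derivative of \<open>\<eta>\<^sup>m\<^sup>+\<^sup>1 \<kappa>(s + b \<eta>\<^sup>2)\<close>. This is how the derivative of a rescaled integral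
  in its upper limit becomes visible in terms of moments.
\<close>

lemma moment_by_parts:
  fixes \<kappa> :: "real \<Rightarrow> real"
  assumes der: "\<And>v. (\<kappa> has_field_derivative \<kappa>' v) (at v)" and cont: "continuous_on UNIV \<kappa>'"
    and n: "n = m + 2"
  shows "real (Suc m) * moment \<kappa> m s b + 2 * b * moment \<kappa>' n s b = \<kappa> (s + b)"
proof -
  have contk: "continuous_on UNIV \<kappa>"
    using der by (meson DERIV_isCont continuous_at_imp_continuous_on)
  have c: "continuous_on {0..1} (\<lambda>\<eta>. \<eta> ^ m * \<kappa> (s + b * \<eta>\<^sup>2))" "continuous_on {0..1} (\<lambda>\<eta>. \<eta> ^ n * \<kappa>' (s + b * \<eta>\<^sup>2))"
    using moment_integrand_continuous[OF contk, of s b m] moment_integrand_continuous[OF cont, of s b n] by auto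
  let ?f = "\<lambda>\<eta>. real (Suc m) * (\<eta> ^ m * \<kappa> (s + b * \<eta>\<^sup>2)) + (2 * b) * (\<eta> ^ n * \<kappa>' (s + b * \<eta>\<^sup>2))"
  have "(?f has_integral 1 ^ Suc m * \<kappa> (s + b * 1\<^sup>2) - 0 ^ Suc m * \<kappa> (s + b * 0\<^sup>2)) {0..1}"
  proof (rule fundamental_theorem_of_calculus)
    show "((\<lambda>\<eta>. \<eta> ^ Suc m * \<kappa> (s + b * \<eta>\<^sup>2)) has_vector_derivative ?f \<eta>) (at \<eta> within {0..1})" for \<eta>
      unfolding has_real_derivative_iff_has_vector_derivative[symmetric] n
      by (rule derivative_eq_intros DERIV_chain2[OF der] refl)+ (simp add: power2_eq_square algebra_simps)
  qed simp
  then have "integral {0..1} ?f = \<kappa> (s + b)"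
    by (simp add: integral_unique)
  moreover have "integral {0..1} ?f
     = integral {0..1} (\<lambda>\<eta>. real (Suc m) * (\<eta> ^ m * \<kappa> (s + b * \<eta>\<^sup>2))) + integral {0..1} (\<lambda>\<eta>. (2 * b) * (\<eta> ^ n * \<kappa>' (s + b * \<eta>\<^sup>2)))"
    by (intro Henstock_Kurzweil_Integration.integral_add integrable_continuous_interval continuous_on_mult_left c)
  ultimately show ?thesis by (simp add: moment_def)
qed

section \<open>The two charts and their complex extensions\<close>

text \<open>
  Both charts use the coordinates \<open>(\<psi>, b, x)\<close>: initial angle, \<open>b = c x\<^sup>2 / 2\<close>, and final abscissa \<open>x\<close>. The first
  yields the parameters \<open>(\<psi>, c, t)\<close> of the exponential mapping, the second the endpoint.
\<close>

definition time_chart :: "('a \<Rightarrow> 'a) \<Rightarrow> 'a \<times> 'a \<times> 'a \<Rightarrow> 'a \<times> 'a \<times> 'a::{banach, real_normed_field}" where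
  "time_chart \<kappa> = (\<lambda>(\<psi>, b, x). (\<psi>, 2 * b / x\<^sup>2, x * moment \<kappa> 0 (sinh \<psi>) b))"

definition endpoint_chart :: "('a \<Rightarrow> 'a) \<Rightarrow> 'a \<times> 'a \<times> 'a \<Rightarrow> 'a \<times> 'a \<times> 'a::{banach, real_normed_field}" where
  "endpoint_chart \<gamma> = (\<lambda>(\<psi>, b, x). (x, x * moment \<gamma> 0 (sinh \<psi>) b, x ^ 3 * moment \<gamma> 2 (sinh \<psi>) b / 2))"

text \<open>
  Along an extremal \<open>dt/dx = 1 / cosh \<psi>\<close> and \<open>dy/dx = tanh \<psi>\<close>; these kernels are their expressions in
  \<open>v = sinh \<psi>\<close>.
\<close>

definition csech_arsinh :: "complex \<Rightarrow> complex" where "csech_arsinh v = 1 / csqrt (1 + v\<^sup>2)"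
definition sech_arsinh :: "real \<Rightarrow> real" where "sech_arsinh v = 1 / sqrt (1 + v\<^sup>2)"

text \<open>
  On this strip \<open>Re (1 + v\<^sup>2) > 0\<close>, so the principal square root is holomorphic there.
\<close>

definition strip :: "complex set" where "strip = {v. \<bar>Im v\<bar> < 1}"

lemma strip_square: "v \<in> strip \<Longrightarrow> 1 + v\<^sup>2 \<notin> \<real>\<^sub>\<le>\<^sub>0"
proof -
  assume "v \<in> strip"
  then have "(Im v)\<^sup>2 < 1" by (simp add: strip_def abs_square_less_1)
  moreover have "Re (1 + v\<^sup>2) = 1 + (Re v)\<^sup>2 - (Im v)\<^sup>2" by (simp add: Re_power2)
  moreover have "0 \<le> (Re v)\<^sup>2" by simp
  ultimately have "0 < Re (1 + v\<^sup>2)" by linarith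
  then show ?thesis by (auto simp: complex_nonpos_Reals_iff)
qed

lemma csqrt_strip: "v \<in> strip \<Longrightarrow> csqrt (1 + v\<^sup>2) \<noteq> 0"
  using strip_square by fastforce

lemma csech_arsinh_deriv:
  assumes "v \<in> strip"
  shows "(csech_arsinh has_field_derivative - v * csech_arsinh v ^ 3) (at v)"
    and "((\<lambda>v. v * csech_arsinh v) has_field_derivative csech_arsinh v ^ 3) (at v)"
proof -
  note nz = csqrt_strip[OF assms]
  show 1: "(csech_arsinh has_field_derivative - v * csech_arsinh v ^ 3) (at v)"
    unfolding csech_arsinh_def[abs_def]
    by (rule derivative_eq_intros refl strip_square[OF assms] nz | simp)+
      (use nz in \<open>simp add: divide_simps power2_eq_square power3_eq_cube\<close>)
  have "csech_arsinh v ^ 2 * (1 + v\<^sup>2) = 1"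
    using nz strip_square[OF assms] by (auto simp: csech_arsinh_def power_divide)
  then have "1 * csech_arsinh v + - v * csech_arsinh v ^ 3 * v = csech_arsinh v ^ 3"
    by algebra
  then show "((\<lambda>v. v * csech_arsinh v) has_field_derivative csech_arsinh v ^ 3) (at v)"
    using DERIV_mult[OF DERIV_ident 1] by simp
qed

lemma csech_arsinh_continuous: "continuous_on strip csech_arsinh"
  using csech_arsinh_deriv(1) by (meson DERIV_isCont continuous_at_imp_continuous_on)

lemma one_plus_square_pos: "0 < 1 + v\<^sup>2" for v :: real
  by (rule add_pos_nonneg) simp_all

lemma sqrt_one_plus_square_pos: "0 < sqrt (1 + v\<^sup>2)" for v :: real
  by (rule real_sqrt_gt_zero[OF one_plus_square_pos])

lemma sech_arsinh_pos: "0 < sech_arsinh v"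
  unfolding sech_arsinh_def by (intro divide_pos_pos sqrt_one_plus_square_pos) simp

lemma sech_arsinh_square: "sech_arsinh v ^ 2 * (1 + v\<^sup>2) = 1"
  using one_plus_square_pos[of v] by (simp add: sech_arsinh_def power_divide)

lemma csech_arsinh_of_real: "csech_arsinh (of_real v) = of_real (sech_arsinh v)"
proof -
  have "csqrt (1 + (of_real v)\<^sup>2) = of_real (sqrt (1 + v\<^sup>2))"
    using of_real_sqrt[OF less_imp_le[OF one_plus_square_pos[of v]]] by simp
  then show ?thesis by (simp add: csech_arsinh_def sech_arsinh_def)
qed

lemma sech_arsinh_deriv:
  "(sech_arsinh has_field_derivative - v * sech_arsinh v ^ 3) (at v)"
  "((\<lambda>v. v * sech_arsinh v) has_field_derivative sech_arsinh v ^ 3) (at v)"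
proof -
  note nz = sqrt_one_plus_square_pos[of v]
  note p = one_plus_square_pos[of v]
  show 1: "(sech_arsinh has_field_derivative - v * sech_arsinh v ^ 3) (at v)"
  proof -
    have "((\<lambda>v. 1 + v\<^sup>2) has_field_derivative 2 * v) (at v)"
      by (auto intro!: derivative_eq_intros)
    from DERIV_inverse_fun[OF DERIV_chain2[OF DERIV_real_sqrt[OF p] this]] nz
    show ?thesis
      by (simp add: sech_arsinh_def[abs_def] divide_simps power2_eq_square power3_eq_cube mult.commute)
  qed
  have "1 * sech_arsinh v + - v * sech_arsinh v ^ 3 * v = sech_arsinh v ^ 3"
    using sech_arsinh_square[of v] by algebra
  then show "((\<lambda>v. v * sech_arsinh v) has_field_derivative sech_arsinh v ^ 3) (at v)"
    using DERIV_mult[OF DERIV_ident 1] by simp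
qed

lemma continuous_on_sech_arsinh: "continuous_on S sech_arsinh"
  using sech_arsinh_deriv(1) by (meson DERIV_isCont continuous_at_imp_continuous_on)

definition tanh_arsinh :: "real \<Rightarrow> real" where "tanh_arsinh v = v * sech_arsinh v"

lemma tanh_arsinh_deriv: "(tanh_arsinh has_field_derivative sech_arsinh v ^ 3) (at v)"
  using sech_arsinh_deriv(2) unfolding tanh_arsinh_def[abs_def] .

lemma continuous_on_tanh_arsinh: "continuous_on S tanh_arsinh"
  unfolding tanh_arsinh_def[abs_def] by (intro continuous_intros continuous_on_sech_arsinh)

lemma sinh_of_real: "sinh (of_real x) = (of_real (sinh x) :: 'a :: {banach, real_normed_field})"
  by (simp add: sinh_def scaleR_conv_of_real flip: exp_of_real of_real_minus)

lemma cosh_of_real: "cosh (of_real x) = (of_real (cosh x) :: 'a :: {banach, real_normed_field})"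
  by (simp add: cosh_def scaleR_conv_of_real flip: exp_of_real of_real_minus)

lemma chart_derivatives:
  fixes \<kappa> :: "'a \<Rightarrow> 'a::{banach, real_normed_field}"
  assumes U: "open U" "(sinh \<psi>, b) \<in> U" and x: "x \<noteq> 0"
    and US: "\<And>s b \<eta>. (s, b) \<in> U \<Longrightarrow> \<eta> \<in> {0..1} \<Longrightarrow> s + b * (of_real \<eta>)\<^sup>2 \<in> S"
    and der: "\<And>v. v \<in> S \<Longrightarrow> (\<kappa> has_field_derivative \<kappa>' v) (at v)"
    and cont: "continuous_on S \<kappa>'"
  defines "M \<equiv> \<lambda>m. moment \<kappa> m (sinh \<psi>) b" and "M' \<equiv> \<lambda>m. moment \<kappa>' m (sinh \<psi>) b"
  shows "(time_chart \<kappa> has_derivative (\<lambda>(p, q, t). (p, 2 * q / x\<^sup>2 - 4 * b * t / x ^ 3,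
            t * M 0 + x * (M' 0 * (cosh \<psi> * p) + M' 2 * q)))) (at (\<psi>, b, x))"
    and "(endpoint_chart \<kappa> has_derivative (\<lambda>(p, q, t). (t,
            t * M 0 + x * (M' 0 * (cosh \<psi> * p) + M' 2 * q),
            3 * x\<^sup>2 * t * M 2 / 2 + x ^ 3 * (M' 2 * (cosh \<psi> * p) + M' 4 * q) / 2))) (at (\<psi>, b, x))"
proof -
  have inner: "((\<lambda>z. (sinh (fst z), fst (snd z))) has_derivative (\<lambda>d. (cosh \<psi> * fst d, fst (snd d)))) (at (\<psi>, b, x))"
  proof -
    have "(sinh has_field_derivative cosh \<psi>) (at \<psi>)" by (auto intro!: derivative_eq_intros)
    then have "((\<lambda>z. sinh (fst z)) has_derivative (\<lambda>d. cosh \<psi> * fst d)) (at (\<psi>, b, x))"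
      using has_derivative_compose[of fst fst "(\<psi>, b, x)" UNIV sinh "(*) (cosh \<psi>)"]
      by (simp add: has_field_derivative_def has_derivative_fst)
    then show ?thesis
      by (intro has_derivative_Pair has_derivative_fst has_derivative_snd has_derivative_ident)
  qed
  have "((\<lambda>z. moment \<kappa> m (sinh (fst z)) (fst (snd z))) has_derivative
      (\<lambda>d. M' m * (cosh \<psi> * fst d) + M' (m + 2) * fst (snd d))) (at (\<psi>, b, x))" for m
  proof -
    have "((\<lambda>p. moment \<kappa> m (fst p) (snd p)) has_derivative (\<lambda>d. M' m * fst d + M' (m + 2) * snd d))
        (at (sinh (fst (\<psi>, b, x)), fst (snd (\<psi>, b, x))))"
      using moment_has_derivative[OF U US der cont, of m] by (simp only: M'_def fst_conv snd_conv)
    from has_derivative_compose[OF inner this] show ?thesis by (simp only: fst_conv snd_conv)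
  qed
  from this[of 0] this[of 2]
  have m0: "((\<lambda>z. moment \<kappa> 0 (sinh (fst z)) (fst (snd z))) has_derivative
      (\<lambda>d. M' 0 * (cosh \<psi> * fst d) + M' 2 * fst (snd d))) (at (\<psi>, b, x))"
    and m2: "((\<lambda>z. moment \<kappa> 2 (sinh (fst z)) (fst (snd z))) has_derivative
      (\<lambda>d. M' 2 * (cosh \<psi> * fst d) + M' 4 * fst (snd d))) (at (\<psi>, b, x))"
    by (simp_all add: numeral_eq_Suc)
  let ?z = "(\<psi>, b, x)"
  have X: "((\<lambda>z. snd (snd z)) has_derivative (\<lambda>d. snd (snd d))) (at ?z)"
    and B: "((\<lambda>z. 2 * fst (snd z)) has_derivative (\<lambda>d. 2 * fst (snd d))) (at ?z)"
    by (intro has_derivative_mult_right has_derivative_fst has_derivative_snd has_derivative_ident)+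
  have X2: "((\<lambda>z. (snd (snd z))\<^sup>2) has_derivative (\<lambda>d. 2 * x * snd (snd d))) (at ?z)"
    by (rule has_derivative_eq_rhs[OF has_derivative_power[OF X]]) (simp add: fun_eq_iff)
  have X3: "((\<lambda>z. (snd (snd z)) ^ 3) has_derivative (\<lambda>d. 3 * x\<^sup>2 * snd (snd d))) (at ?z)"
    by (rule has_derivative_eq_rhs[OF has_derivative_power[OF X]]) (simp add: fun_eq_iff)
  have ratio: "((\<lambda>z. 2 * fst (snd z) / (snd (snd z))\<^sup>2) has_derivative
      (\<lambda>d. 2 * fst (snd d) / x\<^sup>2 - 4 * b * snd (snd d) / x ^ 3)) (at ?z)"
    by (rule has_derivative_eq_rhs[OF has_derivative_divide'[OF B X2]])
      (use x in \<open>simp_all add: fun_eq_iff divide_simps power2_eq_square power3_eq_cube algebra_simps\<close>)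
  have XM0: "((\<lambda>z. snd (snd z) * moment \<kappa> 0 (sinh (fst z)) (fst (snd z))) has_derivative
      (\<lambda>d. snd (snd d) * M 0 + x * (M' 0 * (cosh \<psi> * fst d) + M' 2 * fst (snd d)))) (at ?z)"
    by (rule has_derivative_eq_rhs[OF has_derivative_mult[OF X m0]]) (simp add: fun_eq_iff M_def)
  have XM2: "((\<lambda>z. snd (snd z) ^ 3 * moment \<kappa> 2 (sinh (fst z)) (fst (snd z)) * (1 / 2)) has_derivative
      (\<lambda>d. (3 * x\<^sup>2 * snd (snd d) * M 2 + x ^ 3 * (M' 2 * (cosh \<psi> * fst d) + M' 4 * fst (snd d))) * (1 / 2))) (at ?z)"
    by (rule has_derivative_eq_rhs[OF has_derivative_mult_left[OF has_derivative_mult[OF X3 m2]]])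
      (simp add: fun_eq_iff M_def)
  have fst: "((\<lambda>z. fst z) has_derivative (\<lambda>d. fst d)) (at ?z)"
    by (intro has_derivative_fst has_derivative_ident)
  show "(time_chart \<kappa> has_derivative (\<lambda>(p, q, t). (p, 2 * q / x\<^sup>2 - 4 * b * t / x ^ 3,
            t * M 0 + x * (M' 0 * (cosh \<psi> * p) + M' 2 * q)))) (at ?z)"
    unfolding time_chart_def split_def by (intro has_derivative_Pair fst ratio XM0)
  show "(endpoint_chart \<kappa> has_derivative (\<lambda>(p, q, t). (t,
            t * M 0 + x * (M' 0 * (cosh \<psi> * p) + M' 2 * q),
            3 * x\<^sup>2 * t * M 2 / 2 + x ^ 3 * (M' 2 * (cosh \<psi> * p) + M' 4 * q) / 2))) (at ?z)"
    using has_derivative_Pair[OF X has_derivative_Pair[OF XM0 XM2]]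
    by (simp add: endpoint_chart_def split_def add_divide_distrib)
qed

text \<open>
  The first condition keeps \<open>sinh \<psi> + b \<eta>\<^sup>2\<close> in the strip for all \<open>\<eta> \<in> [0, 1]\<close>.
\<close>

definition complex_charts_domain :: "(complex \<times> complex \<times> complex) set" where
  "complex_charts_domain = {(\<psi>, b, x). \<bar>Im (sinh \<psi>)\<bar> + \<bar>Im b\<bar> < 1 \<and> x \<noteq> 0}"

definition real_charts_domain :: "(real \<times> real \<times> real) set" where
  "real_charts_domain = {(\<psi>, b, x). 0 < x}"

lemma open_complex_charts_domain: "open complex_charts_domain"
proof -
  have "continuous_on UNIV (sinh :: complex \<Rightarrow> complex)"
    unfolding sinh_def[abs_def] by (intro continuous_intros)
  then have s: "continuous_on UNIV (\<lambda>z::complex \<times> complex \<times> complex. sinh (fst z))"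
    by (rule continuous_on_compose2) (auto intro!: continuous_intros)
  have "complex_charts_domain = {z. \<bar>Im (sinh (fst z))\<bar> + \<bar>Im (fst (snd z))\<bar> < 1} \<inter> {z. snd (snd z) \<noteq> 0}"
    by (auto simp: complex_charts_domain_def)
  also have "open \<dots>"
    by (intro open_Int open_Collect_less open_Collect_neq continuous_intros s)
  finally show ?thesis .
qed

lemma open_real_charts_domain: "open real_charts_domain"
proof -
  have "real_charts_domain = {z. 0 < snd (snd z)}" by (auto simp: real_charts_domain_def)
  also have "open \<dots>" by (intro open_Collect_less continuous_intros)
  finally show ?thesis .
qed

lemma of_real3_in_complex_charts_domain:
  "u \<in> real_charts_domain \<Longrightarrow> of_real3 u \<in> complex_charts_domain"
  by (auto simp: real_charts_domain_def complex_charts_domain_def of_real3_def sinh_of_real)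

lemma strip_segment:
  assumes "\<bar>Im s\<bar> + \<bar>Im b\<bar> < 1" "\<eta> \<in> {0..1::real}"
  shows "s + b * (of_real \<eta>)\<^sup>2 \<in> strip"
proof -
  have "\<bar>Im b\<bar> * \<eta>\<^sup>2 \<le> \<bar>Im b\<bar> * 1"
    using assms(2) by (intro mult_left_mono power_le_one) auto
  moreover have "Im (s + b * (of_real \<eta>)\<^sup>2) = Im s + Im b * \<eta>\<^sup>2"
    by (simp flip: of_real_power)
  moreover have "\<bar>Im s + Im b * \<eta>\<^sup>2\<bar> \<le> \<bar>Im s\<bar> + \<bar>Im b\<bar> * \<eta>\<^sup>2"
    using abs_triangle_ineq[of "Im s" "Im b * \<eta>\<^sup>2"] by (simp add: abs_mult)
  ultimately show ?thesis using assms(1) by (simp add: strip_def)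
qed

lemma open_strip_pairs: "open {(s, b). \<bar>Im s\<bar> + \<bar>Im b\<bar> < 1}"
  unfolding split_def by (intro open_Collect_less continuous_intros)

lemma chart_complex_derivatives:
  fixes \<kappa> :: "complex \<Rightarrow> complex"
  assumes z: "(\<psi>, b, x) \<in> complex_charts_domain"
    and der: "\<And>v. v \<in> strip \<Longrightarrow> (\<kappa> has_field_derivative \<kappa>' v) (at v)"
    and cont: "continuous_on strip \<kappa>'"
  defines "M \<equiv> \<lambda>m. moment \<kappa> m (sinh \<psi>) b" and "M' \<equiv> \<lambda>m. moment \<kappa>' m (sinh \<psi>) b"
  shows "complex_derivative3 (time_chart \<kappa>) (\<lambda>(p, q, t). (p, 2 * q / x\<^sup>2 - 4 * b * t / x ^ 3,
            t * M 0 + x * (M' 0 * (cosh \<psi> * p) + M' 2 * q))) (\<psi>, b, x)"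
    and "complex_derivative3 (endpoint_chart \<kappa>) (\<lambda>(p, q, t). (t,
            t * M 0 + x * (M' 0 * (cosh \<psi> * p) + M' 2 * q),
            3 * x\<^sup>2 * t * M 2 / 2 + x ^ 3 * (M' 2 * (cosh \<psi> * p) + M' 4 * q) / 2)) (\<psi>, b, x)"
proof -
  let ?U = "{(s, b). \<bar>Im s\<bar> + \<bar>Im b\<bar> < 1}"
  have mem: "(sinh \<psi>, b) \<in> ?U" and x: "x \<noteq> 0"
    using z by (auto simp: complex_charts_domain_def)
  have seg: "s + b * (of_real \<eta>)\<^sup>2 \<in> strip" if "(s, b) \<in> ?U" "\<eta> \<in> {0..1}" for s b \<eta>
    using strip_segment that by auto
  note D = chart_derivatives[OF open_strip_pairs mem x seg der cont]
  show "complex_derivative3 (time_chart \<kappa>) (\<lambda>(p, q, t). (p, 2 * q / x\<^sup>2 - 4 * b * t / x ^ 3,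
            t * M 0 + x * (M' 0 * (cosh \<psi> * p) + M' 2 * q))) (\<psi>, b, x)"
    using D(1) unfolding complex_derivative3_def M_def M'_def
    by (simp add: cscale_def split_def algebra_simps)
  show "complex_derivative3 (endpoint_chart \<kappa>) (\<lambda>(p, q, t). (t,
            t * M 0 + x * (M' 0 * (cosh \<psi> * p) + M' 2 * q),
            3 * x\<^sup>2 * t * M 2 / 2 + x ^ 3 * (M' 2 * (cosh \<psi> * p) + M' 4 * q) / 2)) (\<psi>, b, x)"
    using D(2) unfolding complex_derivative3_def M_def M'_def
    by (simp add: cscale_def split_def algebra_simps)
qed

lemma complex_derivative3_injI:
  assumes "complex_derivative3 F L z" and "\<And>v. L v = 0 \<Longrightarrow> v = 0"
  shows "inj L"
proof -
  have "linear L"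
    using complex_derivative3D(1)[OF assms(1)] has_derivative_bounded_linear bounded_linear.linear by blast
  then show ?thesis using assms(2) by (simp add: linear_injective_0 del: split_paired_All)
qed

text \<open>
  At a real point, a vector \<open>(p, q, t)\<close> in the kernel of the derivative has \<open>p = 0\<close> and \<open>q = 2 b t / x\<close>; by
  \<open>moment_by_parts\<close> the last component is then \<open>t\<close> times the value \<open>\<kappa>(sinh \<psi> + b) > 0\<close>, so \<open>t = 0\<close>.
\<close>

lemma complex_time_chart:
  obtains D where "\<And>w. w \<in> complex_charts_domain \<Longrightarrow> complex_derivative3 (time_chart csech_arsinh) (D w) w"
    and "\<And>u. u \<in> real_charts_domain \<Longrightarrow> inj (D (of_real3 u))"
proof -
  define \<kappa>' where "\<kappa>' v = - v * csech_arsinh v ^ 3" for v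
  define M where "M m \<psi> b = moment csech_arsinh m (sinh \<psi>) b" for m \<psi> b
  define M' where "M' m \<psi> b = moment \<kappa>' m (sinh \<psi>) b" for m \<psi> b
  define D where "D = (\<lambda>(\<psi>, b, x) (p, q, t). (p, 2 * q / x\<^sup>2 - 4 * b * t / x ^ 3,
            t * M 0 \<psi> b + x * (M' 0 \<psi> b * (cosh \<psi> * p) + M' 2 \<psi> b * q)))"
  have cont: "continuous_on strip \<kappa>'"
    unfolding \<kappa>'_def by (intro continuous_intros csech_arsinh_continuous)
  have D: "complex_derivative3 (time_chart csech_arsinh) (D w) w" if "w \<in> complex_charts_domain" for w
  proof (cases w)
    case (fields \<psi> b x)
    show ?thesis
      using chart_complex_derivatives(1)[OF that[unfolded fields] csech_arsinh_deriv(1)[folded \<kappa>'_def] cont]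
      unfolding fields D_def M_def M'_def by simp
  qed
  have inj: "inj (D (of_real3 u))" if u: "u \<in> real_charts_domain" for u
  proof (rule complex_derivative3_injI[OF D[OF of_real3_in_complex_charts_domain[OF u]]])
    fix v assume v: "D (of_real3 u) v = 0"
    obtain \<psi> b x where uf: "u = (\<psi>, b, x)" by (cases u)
    obtain p q t where vf: "v = (p, q, t)" by (cases v)
    have x: "0 < x" using u by (simp add: uf real_charts_domain_def)
    have M: "M 0 (of_real \<psi>) (of_real b) = of_real (moment sech_arsinh 0 (sinh \<psi>) b)"
      unfolding M_def sinh_of_real by (rule moment_of_real[OF csech_arsinh_of_real continuous_on_sech_arsinh])
    have M': "M' 2 (of_real \<psi>) (of_real b) = of_real (moment (\<lambda>v. - v * sech_arsinh v ^ 3) 2 (sinh \<psi>) b)"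
      unfolding M'_def sinh_of_real
      by (rule moment_of_real) (auto simp: \<kappa>'_def csech_arsinh_of_real intro!: continuous_intros continuous_on_sech_arsinh)
    have cont': "continuous_on UNIV (\<lambda>v. - v * sech_arsinh v ^ 3)"
      by (intro continuous_intros continuous_on_sech_arsinh)
    have p: "p = 0"
      and q: "2 * q / (of_real x)\<^sup>2 - 4 * of_real b * t / of_real x ^ 3 = 0"
      and t: "t * M 0 (of_real \<psi>) (of_real b) + of_real x * (M' 0 (of_real \<psi>) (of_real b) * (cosh (of_real \<psi>) * p)
        + M' 2 (of_real \<psi>) (of_real b) * q) = 0"
      using v unfolding uf vf D_def of_real3_def by (auto simp: zero_prod_def)
    have "q * of_real x = 2 * of_real b * t"
      using q x by (simp add: field_simps power2_eq_square power3_eq_cube)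
    then have "t * (M 0 (of_real \<psi>) (of_real b) + 2 * of_real b * M' 2 (of_real \<psi>) (of_real b)) = 0"
      using t p by (simp add: algebra_simps) (metis mult.assoc mult.left_commute)
    moreover have "M 0 (of_real \<psi>) (of_real b) + 2 * of_real b * M' 2 (of_real \<psi>) (of_real b)
        = of_real (sech_arsinh (sinh \<psi> + b))"
      using moment_by_parts[OF sech_arsinh_deriv(1) cont', of 2 0 "sinh \<psi>" b, symmetric] by (simp add: M M')
    ultimately have "t = 0" using sech_arsinh_pos[of "sinh \<psi> + b"] by simp
    then show "v = 0" using p q x by (simp add: vf zero_prod_def)
  qed
  show ?thesis by (rule that[OF D inj])
qed

text \<open>
  At a real point, a vector \<open>(p, q, t)\<close> in the kernel of the derivative has \<open>t = 0\<close>, and \<open>(cosh \<psi> p, q)\<close> solves a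
  homogeneous real system with matrix \<open>(M\<^sub>0, M\<^sub>2; M\<^sub>2, M\<^sub>4)\<close>, whose determinant is positive by
  \<open>moment_determinant_pos\<close>. The unknowns are complex, but the determinant is real and nonzero.
\<close>

lemma complex_endpoint_chart:
  obtains D where "\<And>w. w \<in> complex_charts_domain \<Longrightarrow>
      complex_derivative3 (endpoint_chart (\<lambda>v. v * csech_arsinh v)) (D w) w"
    and "\<And>u. u \<in> real_charts_domain \<Longrightarrow> inj (D (of_real3 u))"
proof -
  define M where "M m \<psi> b = moment (\<lambda>v. v * csech_arsinh v) m (sinh \<psi>) b" for m \<psi> b
  define M' where "M' m \<psi> b = moment (\<lambda>v. csech_arsinh v ^ 3) m (sinh \<psi>) b" for m \<psi> b
  define D where "D = (\<lambda>(\<psi>, b, x) (p, q, t). (t,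
            t * M 0 \<psi> b + x * (M' 0 \<psi> b * (cosh \<psi> * p) + M' 2 \<psi> b * q),
            3 * x\<^sup>2 * t * M 2 \<psi> b / 2 + x ^ 3 * (M' 2 \<psi> b * (cosh \<psi> * p) + M' 4 \<psi> b * q) / 2))"
  have cont: "continuous_on strip (\<lambda>v. csech_arsinh v ^ 3)"
    by (intro continuous_intros csech_arsinh_continuous)
  have D: "complex_derivative3 (endpoint_chart (\<lambda>v. v * csech_arsinh v)) (D w) w" if "w \<in> complex_charts_domain" for w
  proof (cases w)
    case (fields \<psi> b x)
    show ?thesis
      using chart_complex_derivatives(2)[OF that[unfolded fields] csech_arsinh_deriv(2) cont]
      unfolding fields D_def M_def M'_def by simp
  qed
  have inj: "inj (D (of_real3 u))" if u: "u \<in> real_charts_domain" for u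
  proof (rule complex_derivative3_injI[OF D[OF of_real3_in_complex_charts_domain[OF u]]])
    fix v assume v: "D (of_real3 u) v = 0"
    obtain \<psi> b x where uf: "u = (\<psi>, b, x)" by (cases u)
    obtain p q t where vf: "v = (p, q, t)" by (cases v)
    have x: "0 < x" using u by (simp add: uf real_charts_domain_def)
    have cont': "continuous_on UNIV (\<lambda>v. sech_arsinh v ^ 3)"
      by (intro continuous_intros continuous_on_sech_arsinh)
    define N where "N m = moment (\<lambda>v. sech_arsinh v ^ 3) m (sinh \<psi>) b" for m
    have M': "M' m (of_real \<psi>) (of_real b) = of_real (N m)" for m
      unfolding M'_def N_def sinh_of_real
      by (rule moment_of_real[OF _ cont']) (simp add: csech_arsinh_of_real)
    define p' where "p' = cosh (of_real \<psi>) * p"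
    have t: "t = 0" and e: "of_real (N 0) * p' + of_real (N 2) * q = 0"
        "of_real (N 2) * p' + of_real (N 4) * q = 0"
      using v x unfolding uf vf D_def of_real3_def by (auto simp: zero_prod_def M' p'_def)
    have det: "N 0 * N 4 - (N 2)\<^sup>2 \<noteq> 0"
      using moment_determinant_pos[OF cont', of "sinh \<psi>" b] sech_arsinh_pos by (simp add: N_def)
    have "of_real (N 0 * N 4 - (N 2)\<^sup>2) * p' = 0" "of_real (N 0 * N 4 - (N 2)\<^sup>2) * q = 0"
      using e unfolding of_real_diff of_real_mult of_real_power by algebra+
    then have "p' = 0" "q = 0" using det by (simp_all only: mult_eq_0_iff of_real_eq_0_iff simp_thms)
    moreover have "cosh (of_real \<psi>) \<noteq> (0::complex)" by (simp add: cosh_of_real)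
    ultimately show "v = 0" using t by (simp add: vf zero_prod_def p'_def)
  qed
  show ?thesis by (rule that[OF D inj])
qed

lemma charts_of_real3:
  "time_chart csech_arsinh (of_real3 u) = of_real3 (time_chart sech_arsinh u)"
  "endpoint_chart (\<lambda>v. v * csech_arsinh v) (of_real3 u) = of_real3 (endpoint_chart tanh_arsinh u)"
proof -
  have "moment csech_arsinh m (of_real s) (of_real b) = of_real (moment sech_arsinh m s b)" for m s b
    by (rule moment_of_real[OF csech_arsinh_of_real continuous_on_sech_arsinh])
  moreover have "moment (\<lambda>v. v * csech_arsinh v) m (of_real s) (of_real b) = of_real (moment tanh_arsinh m s b)" for m s b
    by (rule moment_of_real[OF _ continuous_on_tanh_arsinh]) (simp add: tanh_arsinh_def csech_arsinh_of_real)
  ultimately show "time_chart csech_arsinh (of_real3 u) = of_real3 (time_chart sech_arsinh u)"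
    "endpoint_chart (\<lambda>v. v * csech_arsinh v) (of_real3 u) = of_real3 (endpoint_chart tanh_arsinh u)"
    by (simp_all add: time_chart_def endpoint_chart_def of_real3_def split_def sinh_of_real)
qed

lemma real_analytic_chart_transitions:
  fixes f g :: "real \<times> real \<times> real \<Rightarrow> real \<times> real \<times> real"
  defines "P \<equiv> time_chart sech_arsinh" and "Q \<equiv> endpoint_chart tanh_arsinh" and "U \<equiv> real_charts_domain"
  shows "inj_on P U \<Longrightarrow> (\<And>u. u \<in> U \<Longrightarrow> f (P u) = Q u) \<Longrightarrow> real_analytic_on f (P ` U) \<and> open (P ` U)"
    and "inj_on Q U \<Longrightarrow> (\<And>u. u \<in> U \<Longrightarrow> g (Q u) = P u) \<Longrightarrow> real_analytic_on g (Q ` U) \<and> open (Q ` U)"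
proof -
  obtain DP where DP: "\<And>w. w \<in> complex_charts_domain \<Longrightarrow> complex_derivative3 (time_chart csech_arsinh) (DP w) w"
    "\<And>u. u \<in> real_charts_domain \<Longrightarrow> inj (DP (of_real3 u))" by (rule complex_time_chart) (rule that)
  obtain DQ where DQ: "\<And>w. w \<in> complex_charts_domain \<Longrightarrow> complex_derivative3 (endpoint_chart (\<lambda>v. v * csech_arsinh v)) (DQ w) w"
    "\<And>u. u \<in> real_charts_domain \<Longrightarrow> inj (DQ (of_real3 u))" by (rule complex_endpoint_chart) (rule that)
  have P: "\<exists>L. complex_derivative3 (time_chart csech_arsinh) L w"
    and Q: "\<exists>L. complex_derivative3 (endpoint_chart (\<lambda>v. v * csech_arsinh v)) L w" if "w \<in> complex_charts_domain" for w
    by (intro exI[of _ "DP w"] exI[of _ "DQ w"] DP(1) DQ(1) that)+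
  note dom = open_real_charts_domain
  note W = open_complex_charts_domain of_real3_in_complex_charts_domain
  show "real_analytic_on f (P ` U) \<and> open (P ` U)" if "inj_on P U" "\<And>u. u \<in> U \<Longrightarrow> f (P u) = Q u"
    using real_analytic_transition[OF dom that[unfolded P_def Q_def U_def] W Q DP(1) charts_of_real3(2,1) DP(2)]
    unfolding P_def U_def by blast
  show "real_analytic_on g (Q ` U) \<and> open (Q ` U)" if "inj_on Q U" "\<And>u. u \<in> U \<Longrightarrow> g (Q u) = P u"
    using real_analytic_transition[OF dom that[unfolded P_def Q_def U_def] W P DQ(1) charts_of_real3 DQ(2)]
    unfolding Q_def U_def by blast
qed

section \<open>The endpoint chart maps onto the interior of the region\<close>

lemma strict_mono_tanh_arsinh: "strict_mono tanh_arsinh"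
proof (rule strict_monoI)
  fix v w :: real assume "v < w"
  then show "tanh_arsinh v < tanh_arsinh w"
    by (rule DERIV_pos_imp_increasing) (use tanh_arsinh_deriv sech_arsinh_pos in \<open>blast intro: zero_less_power\<close>)
qed

lemma abs_tanh_arsinh_le: "\<bar>tanh_arsinh v\<bar> \<le> 1"
proof -
  have "(tanh_arsinh v)\<^sup>2 = 1 - (sech_arsinh v)\<^sup>2"
    using sech_arsinh_square[of v] by (simp add: tanh_arsinh_def power_mult_distrib algebra_simps)
  then have "(tanh_arsinh v)\<^sup>2 \<le> 1" by simp
  then show ?thesis by (simp add: abs_square_le_1)
qed

lemma sqrt_one_plus_square_deriv:
  "((\<lambda>v. sqrt (1 + v\<^sup>2)) has_field_derivative tanh_arsinh v) (at v)"
proof -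
  have "((\<lambda>v. 1 + v\<^sup>2) has_field_derivative 2 * v) (at v)"
    by (auto intro!: derivative_eq_intros)
  from DERIV_chain2[OF DERIV_real_sqrt[OF one_plus_square_pos] this] show ?thesis
    by (simp add: tanh_arsinh_def sech_arsinh_def divide_simps)
qed

text \<open>
  Strict monotonicity of a gradient: pairing the difference of the two moment vectors with the difference of
  the arguments gives \<open>\<integral> (v\<^sub>1 - v\<^sub>2) (\<gamma> v\<^sub>1 - \<gamma> v\<^sub>2)\<close> with \<open>v\<^sub>i = s\<^sub>i + b\<^sub>i \<eta>\<^sup>2\<close>, whose integrand is nonnegative and
  vanishes only where \<open>v\<^sub>1 = v\<^sub>2\<close>.
\<close>

lemma tanh_arsinh_moments_inj:
  assumes e0: "moment tanh_arsinh 0 s1 b1 = moment tanh_arsinh 0 s2 b2" and e2: "moment tanh_arsinh 2 s1 b1 = moment tanh_arsinh 2 s2 b2"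
  shows "s1 = s2 \<and> b1 = b2"
proof -
  let ?A = "s1 - s2" and ?B = "b1 - b2"
  let ?i = "\<lambda>s b \<eta>. (?A + ?B * \<eta>\<^sup>2) * (\<eta> ^ 0 * tanh_arsinh (s + b * \<eta>\<^sup>2))"
  let ?f = "\<lambda>\<eta>. ?i s1 b1 \<eta> - ?i s2 b2 \<eta>"
  have ci: "continuous_on {0..1} (?i s b)" for s b
    by (intro continuous_intros continuous_on_compose2[OF continuous_on_tanh_arsinh[of UNIV]]) auto
  have cf: "continuous_on {0..1} ?f" by (intro continuous_on_diff ci)
  have nn: "0 \<le> ?f \<eta>" for \<eta>
  proof -
    have "?f \<eta> = ((s1 + b1 * \<eta>\<^sup>2) - (s2 + b2 * \<eta>\<^sup>2)) * (tanh_arsinh (s1 + b1 * \<eta>\<^sup>2) - tanh_arsinh (s2 + b2 * \<eta>\<^sup>2))"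
      by (simp add: algebra_simps)
    then show ?thesis
      using strict_mono_less_eq[OF strict_mono_tanh_arsinh, of "s1 + b1 * \<eta>\<^sup>2" "s2 + b2 * \<eta>\<^sup>2"]
        strict_mono_less_eq[OF strict_mono_tanh_arsinh, of "s2 + b2 * \<eta>\<^sup>2" "s1 + b1 * \<eta>\<^sup>2"]
      by (simp add: zero_le_mult_iff) linarith
  qed
  have "integral {0..1} ?f = integral {0..1} (?i s1 b1) - integral {0..1} (?i s2 b2)"
    by (rule integral_diff) (intro integrable_continuous_interval ci)+
  also have "\<dots> = 0"
    using e0 e2 moment_integral_sum[OF continuous_on_tanh_arsinh, of 2 0] by simp
  finally have z: "\<forall>\<eta>\<in>{0..1}. ?f \<eta> = 0"
    using integral_eq_0_iff[OF cf zero_less_one nn] by blast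
  have "s1 + b1 * \<eta>\<^sup>2 = s2 + b2 * \<eta>\<^sup>2" if "\<eta> \<in> {0..1}" for \<eta>
  proof -
    have "((s1 + b1 * \<eta>\<^sup>2) - (s2 + b2 * \<eta>\<^sup>2)) * (tanh_arsinh (s1 + b1 * \<eta>\<^sup>2) - tanh_arsinh (s2 + b2 * \<eta>\<^sup>2)) = 0"
      using bspec[OF z that] by (simp add: algebra_simps)
    then show ?thesis using strict_mono_eq[OF strict_mono_tanh_arsinh] by auto
  qed
  from this[of 0] this[of 1] show ?thesis by simp
qed

text \<open>
  The integrand is \<open>s + b \<eta>\<^sup>2\<close> times the bang-bang function that switches from \<open>-1\<close> to \<open>1\<close> at \<open>\<tau>\<close>.
\<close>

lemma bang_bang_integral:
  fixes s b \<tau> :: real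
  assumes "\<tau> \<in> {0..1}"
  shows "((\<lambda>\<eta>. if \<eta> \<le> \<tau> then - (s + b * \<eta>\<^sup>2) else s + b * \<eta>\<^sup>2) has_integral
     s * (1 - 2 * \<tau>) + b * (1 / 3 - 2 * \<tau> ^ 3 / 3)) {0..1}" (is "(?h has_integral _) _")
proof -
  let ?F = "\<lambda>\<eta>. s * \<eta> + b * \<eta> ^ 3 / 3"
  have F: "(?F has_vector_derivative s + b * \<eta>\<^sup>2) (at \<eta> within S)" for \<eta> S
    unfolding has_real_derivative_iff_has_vector_derivative[symmetric]
    by (auto intro!: derivative_eq_intros)
  have FTC: "((\<lambda>\<eta>. s + b * \<eta>\<^sup>2) has_integral ?F v - ?F u) {u..v}" if "u \<le> v" for u v
    using that F by (rule fundamental_theorem_of_calculus)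
  have "(?h has_integral - (?F \<tau> - ?F 0)) {0..\<tau>}"
    by (rule has_integral_eq[OF _ has_integral_neg[OF FTC]]) (use assms in auto)
  moreover have "(?h has_integral ?F 1 - ?F \<tau>) {\<tau>..1}"
    by (rule has_integral_spike_finite[of "{\<tau>}", OF _ _ FTC]) (use assms in auto)
  ultimately have "(?h has_integral - (?F \<tau> - ?F 0) + (?F 1 - ?F \<tau>)) {0..1}"
    using assms by (intro has_integral_combine[where c = \<tau>]) auto
  then show ?thesis by (simp add: algebra_simps)
qed

lemma continuous_on_abs_quadratic: "continuous_on {0..1} (\<lambda>\<eta>. \<bar>s + b * \<eta>\<^sup>2\<bar> :: real)"
  by (intro continuous_intros)

lemma bang_bang_le:
  fixes s b \<tau> :: real
  assumes "\<tau> \<in> {0..1}"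
  shows "s * (1 - 2 * \<tau>) + b * (1 / 3 - 2 * \<tau> ^ 3 / 3) \<le> moment abs 0 s b"
proof -
  have "((\<lambda>\<eta>. \<bar>s + b * \<eta>\<^sup>2\<bar>) has_integral moment abs 0 s b) {0..1}"
    using integrable_integral[OF integrable_continuous_interval[OF continuous_on_abs_quadratic[of s b]]]
    by (simp add: moment_def)
  from has_integral_le[OF bang_bang_integral[OF assms] this] show ?thesis
    by (simp add: abs_if)
qed

text \<open>
  Equality in \<open>bang_bang_le\<close> when the quadratic changes its sign exactly at the switching point.
\<close>

lemma bang_bang_eq:
  fixes \<tau> :: real
  assumes "\<tau> \<in> {0..1}"
  shows "moment abs 0 (- \<tau>\<^sup>2) 1 = 1 / 3 - \<tau>\<^sup>2 + 4 * \<tau> ^ 3 / 3"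
proof -
  have "(if \<eta> \<le> \<tau> then - (- \<tau>\<^sup>2 + 1 * \<eta>\<^sup>2) else - \<tau>\<^sup>2 + 1 * \<eta>\<^sup>2) = \<bar>- \<tau>\<^sup>2 + 1 * \<eta>\<^sup>2\<bar>" if "\<eta> \<in> {0..1}" for \<eta>
  proof (cases "\<eta> \<le> \<tau>")
    case True
    then have "\<eta>\<^sup>2 \<le> \<tau>\<^sup>2" using that by (intro power_mono) auto
    then show ?thesis using True by simp
  next
    case False
    then have "\<tau>\<^sup>2 \<le> \<eta>\<^sup>2" using assms by (intro power_mono) auto
    then show ?thesis using False by simp
  qed
  from has_integral_eq[OF this bang_bang_integral[OF assms]]
  have "((\<lambda>\<eta>. \<bar>- \<tau>\<^sup>2 + 1 * \<eta>\<^sup>2\<bar>) has_integral - \<tau>\<^sup>2 * (1 - 2 * \<tau>) + 1 * (1 / 3 - 2 * \<tau> ^ 3 / 3)) {0..1}" .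
  then have "moment abs 0 (- \<tau>\<^sup>2) 1 = - \<tau>\<^sup>2 * (1 - 2 * \<tau>) + 1 * (1 / 3 - 2 * \<tau> ^ 3 / 3)"
    by (simp add: moment_def integral_unique)
  then show ?thesis by (simp add: algebra_simps power2_eq_square power3_eq_cube)
qed

text \<open>
  The bathtub principle: among functions with values in \<open>[-1, 1]\<close> and given mean \<open>Y\<close>, the second moment is
  largest for the bang-bang function. The proof tests \<open>u\<close> against \<open>\<eta>\<^sup>2 - \<tau>\<^sup>2\<close>, where \<open>\<tau>\<close> is the point at which a
  bang-bang function of mean \<open>Y\<close> has to switch.
\<close>

lemma second_moment_le:
  fixes u :: "real \<Rightarrow> real"
  assumes u: "continuous_on {0..1} u" "\<And>\<eta>. \<eta> \<in> {0..1} \<Longrightarrow> \<bar>u \<eta>\<bar> \<le> 1"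
  defines "Y \<equiv> integral {0..1} u" and "N \<equiv> integral {0..1} (\<lambda>\<eta>. \<eta>\<^sup>2 * u \<eta>)"
  shows "\<bar>Y\<bar> \<le> 1" and "N \<le> (4 - (1 - Y) ^ 3) / 12"
proof -
  have "norm Y \<le> 1 * (1 - 0)" unfolding Y_def
    by (rule integral_bound) (use u in auto)
  then show Y: "\<bar>Y\<bar> \<le> 1" by simp
  define \<tau> where "\<tau> = (1 - Y) / 2"
  have \<tau>: "\<tau> \<in> {0..1}" using Y by (auto simp: \<tau>_def)
  have c: "continuous_on {0..1} (\<lambda>\<eta>. \<eta>\<^sup>2 * u \<eta>)" "continuous_on {0..1} (\<lambda>\<eta>. - \<tau>\<^sup>2 * u \<eta>)"
    by (intro continuous_intros u)+
  have "((\<lambda>\<eta>. - \<tau>\<^sup>2 * u \<eta> + \<eta>\<^sup>2 * u \<eta>) has_integral - \<tau>\<^sup>2 * Y + N) {0..1}"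
    unfolding Y_def N_def
    by (intro has_integral_add has_integral_mult_right integrable_integral integrable_continuous_interval c u)
  moreover have "((\<lambda>\<eta>. \<bar>- \<tau>\<^sup>2 + 1 * \<eta>\<^sup>2\<bar>) has_integral moment abs 0 (- \<tau>\<^sup>2) 1) {0..1}"
    using integrable_integral[OF integrable_continuous_interval[OF continuous_on_abs_quadratic[of "- \<tau>\<^sup>2" 1]]]
    by (simp add: moment_def)
  moreover have "- \<tau>\<^sup>2 * u \<eta> + \<eta>\<^sup>2 * u \<eta> \<le> \<bar>- \<tau>\<^sup>2 + 1 * \<eta>\<^sup>2\<bar>" if "\<eta> \<in> {0..1}" for \<eta>
  proof -
    have "\<bar>(- \<tau>\<^sup>2 + \<eta>\<^sup>2) * u \<eta>\<bar> \<le> \<bar>- \<tau>\<^sup>2 + \<eta>\<^sup>2\<bar> * 1"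
      unfolding abs_mult using u(2)[OF that] by (intro mult_left_mono) auto
    then show ?thesis by (simp add: left_diff_distrib abs_le_iff)
  qed
  ultimately have "- \<tau>\<^sup>2 * Y + N \<le> moment abs 0 (- \<tau>\<^sup>2) 1" by (rule has_integral_le)
  then have le: "- \<tau>\<^sup>2 * Y + N \<le> 1 / 3 - \<tau>\<^sup>2 + 4 * \<tau> ^ 3 / 3" by (simp only: bang_bang_eq[OF \<tau>])
  have Y_\<tau>: "Y = 1 - 2 * \<tau>" by (simp add: \<tau>_def field_simps)
  have "N \<le> 1 / 3 - 2 * \<tau> ^ 3 / 3"
    using le unfolding Y_\<tau> by (simp add: algebra_simps power2_eq_square power3_eq_cube)
  also have "\<dots> = (4 - (1 - Y) ^ 3) / 12"
    by (simp add: Y_\<tau> power_mult_distrib field_simps)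
  finally show "N \<le> (4 - (1 - Y) ^ 3) / 12" .
qed

lemma B2_bounds_scale:
  fixes x Y :: real
  shows "(4 * x ^ 3 - (x - x * Y) ^ 3) / 24 = x ^ 3 * ((4 - (1 - Y) ^ 3) / 12) / 2"
    and "((x + x * Y) ^ 3 - 4 * x ^ 3) / 24 = x ^ 3 * (- ((4 - (1 + Y) ^ 3) / 12)) / 2"
proof -
  have "x - x * Y = x * (1 - Y)" "x + x * Y = x * (1 + Y)" by (simp_all add: algebra_simps)
  then show "(4 * x ^ 3 - (x - x * Y) ^ 3) / 24 = x ^ 3 * ((4 - (1 - Y) ^ 3) / 12) / 2"
    and "((x + x * Y) ^ 3 - 4 * x ^ 3) / 24 = x ^ 3 * (- ((4 - (1 + Y) ^ 3) / 12)) / 2"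
    by (simp_all only: power_mult_distrib) (simp_all add: field_simps)
qed

text \<open>
  The region is invariant under the dilations \<open>(x, y, z) \<mapsto> (r x, r y, r\<^sup>3 z)\<close>, and its section at \<open>x = 1\<close>, in the
  coordinates \<open>(y, 2 z)\<close>, is the region of moments from \<open>second_moment_le\<close>. The lower bound is the upper one for \<open>-u\<close>.
\<close>

lemma B2_scale:
  assumes "0 < x"
  shows "(x, x * Y, x ^ 3 * N / 2) \<in> B2 \<longleftrightarrow>
    \<bar>Y\<bar> \<le> 1 \<and> N \<le> (4 - (1 - Y) ^ 3) / 12 \<and> - N \<le> (4 - (1 + Y) ^ 3) / 12"
proof -
  have 1: "\<bar>x * Y\<bar> \<le> x \<longleftrightarrow> \<bar>Y\<bar> \<le> 1" using assms by (simp add: abs_mult)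
  have cmp: "x ^ 3 * A / 2 \<le> x ^ 3 * B / 2 \<longleftrightarrow> A \<le> B" for A B
    using assms by simp
  have 2: "x ^ 3 * N / 2 \<le> (4 * x ^ 3 - (x - x * Y) ^ 3) / 24 \<longleftrightarrow> N \<le> (4 - (1 - Y) ^ 3) / 12"
    by (simp only: B2_bounds_scale cmp)
  have 3: "((x + x * Y) ^ 3 - 4 * x ^ 3) / 24 \<le> x ^ 3 * N / 2 \<longleftrightarrow> - ((4 - (1 + Y) ^ 3) / 12) \<le> N"
    by (simp only: B2_bounds_scale cmp)
  show ?thesis
    unfolding B2_def mem_Collect_eq prod.case 1 2 3
    using minus_le_iff[of N "(4 - (1 + Y) ^ 3) / 12"] minus_le_iff[of "(4 - (1 + Y) ^ 3) / 12" N] by blast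
qed

lemma endpoint_chart_in_B2:
  assumes "u \<in> real_charts_domain"
  shows "endpoint_chart tanh_arsinh u \<in> B2"
proof -
  obtain \<psi> b x where u: "u = (\<psi>, b, x)" by (cases u)
  have x: "0 < x" using assms by (simp add: u real_charts_domain_def)
  let ?v = "\<lambda>\<eta>. tanh_arsinh (sinh \<psi> + b * \<eta>\<^sup>2)"
  have c: "continuous_on {0..1} ?v"
    by (intro continuous_intros continuous_on_compose2[OF continuous_on_tanh_arsinh[of UNIV]]) auto
  note le = second_moment_le[OF c abs_tanh_arsinh_le]
    second_moment_le[OF continuous_on_minus[OF c] abs_tanh_arsinh_le[THEN eq_refl[OF abs_minus_cancel, THEN order_trans]]]
  show ?thesis
    using le B2_scale[OF x, of "moment tanh_arsinh 0 (sinh \<psi>) b" "moment tanh_arsinh 2 (sinh \<psi>) b"]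
    by (simp add: endpoint_chart_def u moment_def)
qed

lemma endpoint_chart_inj: "inj_on (endpoint_chart tanh_arsinh) real_charts_domain"
proof (rule inj_onI)
  fix u v assume u: "u \<in> real_charts_domain" and v: "v \<in> real_charts_domain"
    and eq: "endpoint_chart tanh_arsinh u = endpoint_chart tanh_arsinh v"
  obtain \<psi> b x where uf: "u = (\<psi>, b, x)" by (cases u)
  obtain \<psi>' b' x' where vf: "v = (\<psi>', b', x')" by (cases v)
  have "0 < x" using u by (simp add: uf real_charts_domain_def)
  then show "u = v"
    using eq tanh_arsinh_moments_inj[of "sinh \<psi>" b "sinh \<psi>'" b']
    by (auto simp: uf vf endpoint_chart_def)
qed

lemma interior_B2_strict:
  assumes "(x, y, z) \<in> interior B2"
  shows "\<bar>y\<bar> < x" and "((x + y) ^ 3 - 4 * x ^ 3) / 24 < z" and "z < (4 * x ^ 3 - (x - y) ^ 3) / 24"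
proof -
  obtain e where e: "0 < e" "ball (x, y, z) e \<subseteq> B2" using assms by (auto simp: mem_interior)
  have "(x - e / 2, y, z) \<in> ball (x, y, z) e" "(x, y, z + e / 2) \<in> ball (x, y, z) e"
    "(x, y, z - e / 2) \<in> ball (x, y, z) e"
    using e(1) by (simp_all add: dist_Pair_Pair dist_real_def)
  then have "(x - e / 2, y, z) \<in> B2" "(x, y, z + e / 2) \<in> B2" "(x, y, z - e / 2) \<in> B2"
    using e(2) by blast+
  then show "\<bar>y\<bar> < x" and "((x + y) ^ 3 - 4 * x ^ 3) / 24 < z" and "z < (4 * x ^ 3 - (x - y) ^ 3) / 24"
    using e(1) unfolding B2_def by auto
qed

lemma moment_continuous:
  fixes \<kappa> :: "real \<Rightarrow> real"
  assumes "continuous_on UNIV \<kappa>"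
  shows "continuous_on A (\<lambda>p. moment \<kappa> m (fst p) (snd p))"
  unfolding moment_def cbox_interval[symmetric]
  by (rule integral_continuous_on_param)
    (auto simp: split_def intro!: continuous_intros continuous_on_compose2[OF assms])

lemma moment_abs_scale: "0 \<le> c \<Longrightarrow> moment abs 0 (c * s) (c * b) = c * moment abs 0 s b" for c s b :: real
  by (simp add: moment_def abs_mult mult.assoc flip: distrib_left)

text \<open>
  The vector \<open>(Y, N)\<close> is the gradient of \<open>\<integral> sqrt (1 + (s + b \<eta>\<^sup>2)\<^sup>2) d\<eta>\<close> at a minimum of
  \<open>\<Phi>(s, b) = \<integral> sqrt (1 + (s + b \<eta>\<^sup>2)\<^sup>2) d\<eta> - Y s - N b\<close>. A minimum exists since \<open>\<Phi>\<close> dominates the positively homogeneous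
  function \<open>H(s, b) = \<integral> \<bar>s + b \<eta>\<^sup>2\<bar> d\<eta> - Y s - N b\<close>, which is positive off the origin: for \<open>b > 0\<close> compare with the
  bang-bang function of mean \<open>Y\<close> that switches from \<open>-1\<close> to \<open>1\<close>, for \<open>b < 0\<close> with the one that switches
  from \<open>1\<close> to \<open>-1\<close>, and use the two strict bounds on \<open>N\<close>.
\<close>

lemma tanh_arsinh_moments_surj:
  fixes Y N :: real
  assumes Y: "\<bar>Y\<bar> < 1" and N: "N < (4 - (1 - Y) ^ 3) / 12" "- N < (4 - (1 + Y) ^ 3) / 12"
  obtains s b where "moment tanh_arsinh 0 s b = Y" "moment tanh_arsinh 2 s b = N"
proof -
  define L where "L p = Y * fst p + N * snd p" for p :: "real \<times> real"
  define H where "H p = moment abs 0 (fst p) (snd p) - L p" for p :: "real \<times> real"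
  define \<Phi> where "\<Phi> p = moment (\<lambda>v. sqrt (1 + v\<^sup>2)) 0 (fst p) (snd p) - L p" for p :: "real \<times> real"
  have cabs: "continuous_on UNIV (abs :: real \<Rightarrow> real)" by (intro continuous_intros)
  have csqrt: "continuous_on UNIV (\<lambda>v::real. sqrt (1 + v\<^sup>2))" by (intro continuous_intros)
  have contH: "continuous_on A H" and cont\<Phi>: "continuous_on A \<Phi>" for A
    unfolding H_def \<Phi>_def L_def by (intro continuous_intros moment_continuous cabs csqrt)+
  have Hpos: "0 < H p" if "p \<noteq> 0" for p
  proof -
    obtain s b where p: "p = (s, b)" by (cases p)
    consider "b = 0" "s \<noteq> 0" | "0 < b" | "b < 0" 
      using \<open>p \<noteq> 0\<close> unfolding p zero_prod_def by (cases b "0 :: real" rule: linorder_cases) auto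
    then show ?thesis
    proof cases
      case 1
      have "Y * s \<le> \<bar>Y\<bar> * \<bar>s\<bar>" by (simp flip: abs_mult)
      also have "\<dots> < 1 * \<bar>s\<bar>" using Y 1 by (intro mult_strict_right_mono) auto
      finally show ?thesis using 1 by (simp add: H_def L_def p moment_def)
    next
      case 2
      have \<tau>: "(1 - Y) / 2 \<in> {0..1}" using Y by auto
      have "b * N < b * ((4 - (1 - Y) ^ 3) / 12)" using N(1) 2 by simp
      moreover have "s * (1 - 2 * ((1 - Y) / 2)) + b * (1 / 3 - 2 * ((1 - Y) / 2) ^ 3 / 3)
          = Y * s + b * ((4 - (1 - Y) ^ 3) / 12)"
        by (simp add: power_divide field_simps)
      ultimately show ?thesis using bang_bang_le[OF \<tau>, of s b] by (simp add: H_def L_def p mult.commute)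
    next
      case 3
      have \<tau>: "(1 + Y) / 2 \<in> {0..1}" using Y by auto
      have "(- b) * (- N) < (- b) * ((4 - (1 + Y) ^ 3) / 12)" using N(2) 3 by (intro mult_strict_left_mono) auto
      moreover have "(- s) * (1 - 2 * ((1 + Y) / 2)) + (- b) * (1 / 3 - 2 * ((1 + Y) / 2) ^ 3 / 3)
          = Y * s + (- b) * ((4 - (1 + Y) ^ 3) / 12)"
        by (simp add: power_divide field_simps)
      moreover have "moment abs 0 (- s) (- b) = moment abs 0 s b"
      proof -
        have "\<bar>- s - b * \<eta>\<^sup>2\<bar> = \<bar>s + b * \<eta>\<^sup>2\<bar>" for \<eta> by linarith
        then show ?thesis by (simp add: moment_def)
      qed
      ultimately show ?thesis using bang_bang_le[OF \<tau>, of "- s" "- b"] by (simp add: H_def L_def p mult.commute)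
    qed
  qed
  have "compact (sphere (0 :: real \<times> real) 1)" "sphere (0 :: real \<times> real) 1 \<noteq> {}"
    by (auto intro!: exI[of _ "(1, 0)"] simp: norm_Pair)
  from continuous_attains_inf[OF this contH]
  obtain p1 where p1: "norm p1 = 1" and min1: "\<And>p. norm p = 1 \<Longrightarrow> H p1 \<le> H p" by auto
  define \<epsilon> where "\<epsilon> = H p1"
  have "p1 \<noteq> 0" using p1 by auto
  then have \<epsilon>: "0 < \<epsilon>" unfolding \<epsilon>_def by (rule Hpos)
  have growth: "\<epsilon> * norm p \<le> \<Phi> p" for p
  proof (cases "p = 0")
    case True
    then show ?thesis by (simp add: \<Phi>_def L_def moment_def)
  next
    case False
    then have n: "0 < norm p" by simp
    define q where "q = p /\<^sub>R norm p"
    have "H p1 \<le> H q" using False by (intro min1) (simp add: q_def)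
    moreover have "H p = norm p * H q"
    proof -
      have "fst p = norm p * fst q" "snd p = norm p * snd q" using n by (simp_all add: q_def)
      then show ?thesis
        using moment_abs_scale[of "norm p" "fst q" "snd q"]
        unfolding H_def L_def by (simp add: algebra_simps)
    qed
    ultimately have "\<epsilon> * norm p \<le> H p" using n by (simp add: \<epsilon>_def mult.commute)
    also have "H p \<le> \<Phi> p"
    proof -
      have "\<bar>v\<bar> \<le> sqrt (1 + v\<^sup>2)" for v :: real by (rule real_le_rsqrt) simp
      then have "moment abs 0 (fst p) (snd p) \<le> moment (\<lambda>v. sqrt (1 + v\<^sup>2)) 0 (fst p) (snd p)"
        unfolding moment_def
        by (intro integral_le integrable_continuous_interval moment_integrand_continuous[OF cabs]
            moment_integrand_continuous[OF csqrt]) auto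
      then show ?thesis by (simp add: H_def \<Phi>_def)
    qed
    finally show ?thesis .
  qed
  have \<Phi>0: "\<Phi> 0 = 1" by (simp add: \<Phi>_def L_def moment_def)
  \<comment> \<open>Outside this ball the linear lower bound exceeds \<open>\<Phi> 0 = 1\<close>, so a minimum on the ball is global.\<close>
  have "compact (cball (0 :: real \<times> real) (1 / \<epsilon>))" "cball (0 :: real \<times> real) (1 / \<epsilon>) \<noteq> {}"
    using \<epsilon> by auto
  from continuous_attains_inf[OF this cont\<Phi>]
  obtain p0 where "\<forall>p\<in>cball 0 (1 / \<epsilon>). \<Phi> p0 \<le> \<Phi> p" by blast
  then have p0: "\<Phi> p0 \<le> \<Phi> p" if "norm p \<le> 1 / \<epsilon>" for p
    using that by (metis mem_cball_0)
  have min: "\<Phi> p0 \<le> \<Phi> p" for p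
  proof (cases "norm p \<le> 1 / \<epsilon>")
    case True then show ?thesis by (rule p0)
  next
    case False
    then have "1 < \<epsilon> * norm p" using \<epsilon> by (simp add: field_simps)
    moreover have "\<Phi> p0 \<le> 1" using p0[of 0] \<epsilon> \<Phi>0 by simp
    ultimately show ?thesis using growth[of p] by linarith
  qed
  have "((\<lambda>p. moment (\<lambda>v. sqrt (1 + v\<^sup>2)) 0 (fst p) (snd p)) has_derivative
     (\<lambda>d. moment tanh_arsinh 0 (fst p0) (snd p0) * fst d + moment tanh_arsinh (0 + 2) (fst p0) (snd p0) * snd d)) (at p0)"
    by (rule moment_has_derivative[OF open_UNIV _ _ sqrt_one_plus_square_deriv continuous_on_tanh_arsinh[of UNIV]]) auto
  moreover have "(L has_derivative (\<lambda>d. Y * fst d + N * snd d)) (at p0)"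
    unfolding L_def[abs_def]
    by (intro has_derivative_add has_derivative_mult_right has_derivative_fst has_derivative_snd has_derivative_ident)
  ultimately have "(\<Phi> has_derivative (\<lambda>d. (moment tanh_arsinh 0 (fst p0) (snd p0) * fst d
      + moment tanh_arsinh (0 + 2) (fst p0) (snd p0) * snd d) - (Y * fst d + N * snd d))) (at p0)"
    unfolding \<Phi>_def[abs_def] by (rule has_derivative_diff)
  from differential_zero_maxmin[OF _ open_UNIV this] min
  have "(\<lambda>d. (moment tanh_arsinh 0 (fst p0) (snd p0) * fst d
      + moment tanh_arsinh 2 (fst p0) (snd p0) * snd d) - (Y * fst d + N * snd d)) = (\<lambda>d. 0)"
    by (simp add: numeral_2_eq_2)
  from fun_cong[OF this, of "(1, 0)"] fun_cong[OF this, of "(0, 1)"]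
  show ?thesis by (intro that[of "fst p0" "snd p0"]) simp_all
qed

lemma interior_B2_subset: "interior B2 \<subseteq> endpoint_chart tanh_arsinh ` real_charts_domain"
proof
  fix q assume q: "q \<in> interior B2"
  obtain x y z where qf: "q = (x, y, z)" by (cases q)
  note strict = interior_B2_strict[OF q[unfolded qf]]
  have x: "0 < x" using strict(1) by linarith
  define Y N where "Y = y / x" and "N = 2 * z / x ^ 3"
  have y: "y = x * Y" and z: "z = x ^ 3 * N / 2" using x by (simp_all add: Y_def N_def)
  have cmp: "x ^ 3 * A / 2 < x ^ 3 * B / 2 \<longleftrightarrow> A < B" for A B
    using x by simp
  have "\<bar>x * Y\<bar> < x" using strict(1) y by simp
  then have 1: "\<bar>Y\<bar> < 1" using x by (simp add: abs_mult)
  have 2: "N < (4 - (1 - Y) ^ 3) / 12"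
    using strict(3) unfolding y z by (simp only: B2_bounds_scale cmp)
  have "- ((4 - (1 + Y) ^ 3) / 12) < N"
    using strict(2) unfolding y z by (simp only: B2_bounds_scale cmp)
  then have 3: "- N < (4 - (1 + Y) ^ 3) / 12" by linarith
  obtain s b where "moment tanh_arsinh 0 s b = Y" "moment tanh_arsinh 2 s b = N"
    using tanh_arsinh_moments_surj[OF 1 2 3] .
  then have "endpoint_chart tanh_arsinh (arsinh s, b, x) = q"
    by (simp add: endpoint_chart_def qf y z)
  moreover have "(arsinh s, b, x) \<in> real_charts_domain" using x by (simp add: real_charts_domain_def)
  ultimately show "q \<in> endpoint_chart tanh_arsinh ` real_charts_domain" by blast
qed

section \<open>Extremals as functions of the abscissa\<close>

text \<open>
  The expression \<open>\<xi>\<^sup>m\<^sup>+\<^sup>1 M\<^sub>m[\<kappa>](s, a \<xi>\<^sup>2)\<close> is the integral of \<open>\<zeta>\<^sup>m \<kappa>(s + a \<zeta>\<^sup>2)\<close> from \<open>0\<close> to \<open>\<xi>\<close>, rescaled to the unit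
  interval; here the integral is recognised by its derivative.
\<close>

lemma scaled_moment_deriv:
  fixes \<kappa> :: "real \<Rightarrow> real"
  assumes der: "\<And>v. (\<kappa> has_field_derivative \<kappa>' v) (at v)" and cont: "continuous_on UNIV \<kappa>'"
  shows "((\<lambda>\<xi>. \<xi> ^ Suc m * moment \<kappa> m s (a * \<xi>\<^sup>2)) has_real_derivative \<xi> ^ m * \<kappa> (s + a * \<xi>\<^sup>2)) (at \<xi>)"
proof -
  let ?M' = "\<lambda>n. moment \<kappa>' n s (a * \<xi>\<^sup>2)"
  have curve: "((\<lambda>\<xi>. (s, a * \<xi>\<^sup>2)) has_derivative (\<lambda>h. (0, a * (2 * \<xi> * h)))) (at \<xi>)"
    by (auto intro!: derivative_eq_intros)
  have "((\<lambda>p. moment \<kappa> m (fst p) (snd p)) has_derivative (\<lambda>d. ?M' m * fst d + ?M' (m + 2) * snd d)) (at (s, a * \<xi>\<^sup>2))"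
    using moment_has_derivative[OF open_UNIV _ _ der cont, of "(s, a * \<xi>\<^sup>2)" m] by simp
  from has_derivative_compose[OF curve this]
  have "((\<lambda>\<xi>. moment \<kappa> m s (a * \<xi>\<^sup>2)) has_derivative (\<lambda>h. ?M' (m + 2) * (a * (2 * \<xi> * h)))) (at \<xi>)"
    by simp
  then have "((\<lambda>\<xi>. moment \<kappa> m s (a * \<xi>\<^sup>2)) has_real_derivative ?M' (m + 2) * (2 * a * \<xi>)) (at \<xi>)"
    unfolding has_field_derivative_def by (rule has_derivative_eq_rhs) (simp add: fun_eq_iff)
  from DERIV_mult[OF DERIV_pow[of "Suc m"] this]
  have "((\<lambda>\<xi>. \<xi> ^ Suc m * moment \<kappa> m s (a * \<xi>\<^sup>2)) has_real_derivative
      \<xi> ^ m * (real (Suc m) * moment \<kappa> m s (a * \<xi>\<^sup>2) + 2 * (a * \<xi>\<^sup>2) * ?M' (m + 2))) (at \<xi>)"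
    by (rule DERIV_cong) (simp add: algebra_simps power2_eq_square)
  then show ?thesis
    by (simp only: moment_by_parts[OF der cont refl])
qed

text \<open>
  Time, ordinate and height at the moment when the extremal with \<open>sinh \<psi>0 = s\<close> and \<open>c = 2 a\<close> reaches the
  abscissa \<open>\<xi>\<close>. They are defined for all real \<open>\<xi>\<close>, so that time is a strictly increasing function on the line.
\<close>

definition time_at :: "real \<Rightarrow> real \<Rightarrow> real \<Rightarrow> real" where
  "time_at s a \<xi> = \<xi> * moment sech_arsinh 0 s (a * \<xi>\<^sup>2)"

definition y_at :: "real \<Rightarrow> real \<Rightarrow> real \<Rightarrow> real" where
  "y_at s a \<xi> = \<xi> * moment tanh_arsinh 0 s (a * \<xi>\<^sup>2)"

definition z_at :: "real \<Rightarrow> real \<Rightarrow> real \<Rightarrow> real" where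
  "z_at s a \<xi> = \<xi> ^ 3 * moment tanh_arsinh 2 s (a * \<xi>\<^sup>2) / 2"

lemma time_at_deriv: "(time_at s a has_real_derivative sech_arsinh (s + a * \<xi>\<^sup>2)) (at \<xi>)"
proof -
  have "continuous_on UNIV (\<lambda>v. - v * sech_arsinh v ^ 3)"
    by (intro continuous_intros continuous_on_sech_arsinh)
  from scaled_moment_deriv[OF sech_arsinh_deriv(1) this, of 0] show ?thesis
    by (simp add: time_at_def[abs_def])
qed

lemma
  shows y_at_deriv: "(y_at s a has_real_derivative tanh_arsinh (s + a * \<xi>\<^sup>2)) (at \<xi>)"
    and z_at_deriv: "(z_at s a has_real_derivative \<xi>\<^sup>2 / 2 * tanh_arsinh (s + a * \<xi>\<^sup>2)) (at \<xi>)"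
proof -
  have c: "continuous_on UNIV (\<lambda>v. sech_arsinh v ^ 3)"
    by (intro continuous_intros continuous_on_sech_arsinh)
  show "(y_at s a has_real_derivative tanh_arsinh (s + a * \<xi>\<^sup>2)) (at \<xi>)"
    using scaled_moment_deriv[OF tanh_arsinh_deriv c, of 0] by (simp add: y_at_def[abs_def])
  show "(z_at s a has_real_derivative \<xi>\<^sup>2 / 2 * tanh_arsinh (s + a * \<xi>\<^sup>2)) (at \<xi>)"
    using DERIV_cdivide[OF scaled_moment_deriv[OF tanh_arsinh_deriv c, of 2 s a \<xi>], of 2]
    by (simp add: z_at_def[abs_def] numeral_eq_Suc)
qed

lemma strict_mono_time_at: "strict_mono (time_at s a)"
proof (rule strict_monoI)
  fix v w :: real assume "v < w"
  then show "time_at s a v < time_at s a w"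
    by (rule DERIV_pos_imp_increasing) (use time_at_deriv sech_arsinh_pos in blast)
qed

lemma isCont_time_at: "isCont (time_at s a) \<xi>"
  using time_at_deriv by (rule DERIV_isCont)

lemma time_at_0 [simp]: "time_at s a 0 = 0" and y_at_0 [simp]: "y_at s a 0 = 0"
  and z_at_0 [simp]: "z_at s a 0 = 0"
  by (simp_all add: time_at_def y_at_def z_at_def)

lemma sech_arsinh_conv_cosh: "sech_arsinh v * cosh (arsinh v) = 1" "tanh_arsinh v * cosh (arsinh v) = v"
proof -
  show "sech_arsinh v * cosh (arsinh v) = 1"
    using sqrt_one_plus_square_pos[of v] by (simp add: sech_arsinh_def cosh_arsinh_real add.commute)
  then show "tanh_arsinh v * cosh (arsinh v) = v" by (simp add: tanh_arsinh_def mult.assoc)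
qed

text \<open>
  Uniqueness of the endpoint, without a general uniqueness theorem: \<open>sinh \<psi> - a x\<^sup>2\<close> has derivative zero, and by
  this first integral so have the differences of \<open>\<tau>\<close>, \<open>y\<close>, \<open>z\<close> and the corresponding functions of the abscissa.
\<close>

lemma extremal_endpoint:
  assumes ext: "extremal \<psi>0 c {0..t} \<psi> x y z" and t: "0 \<le> t"
  shows "time_at (sinh \<psi>0) (c / 2) (x t) = t" and "y t = y_at (sinh \<psi>0) (c / 2) (x t)"
    and "z t = z_at (sinh \<psi>0) (c / 2) (x t)"
proof -
  let ?s = "sinh \<psi>0" and ?I = "{0..t}"
  define a where "a = c / 2"
  have init: "\<psi> 0 = \<psi>0" "x 0 = 0" "y 0 = 0" "z 0 = 0"
    and d: "\<And>\<tau>. \<tau> \<in> ?I \<Longrightarrow> (\<psi> has_real_derivative c * x \<tau>) (at \<tau> within ?I)"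
      "\<And>\<tau>. \<tau> \<in> ?I \<Longrightarrow> (x has_real_derivative cosh (\<psi> \<tau>)) (at \<tau> within ?I)"
      "\<And>\<tau>. \<tau> \<in> ?I \<Longrightarrow> (y has_real_derivative sinh (\<psi> \<tau>)) (at \<tau> within ?I)"
      "\<And>\<tau>. \<tau> \<in> ?I \<Longrightarrow> (z has_real_derivative (x \<tau>)\<^sup>2 / 2 * sinh (\<psi> \<tau>)) (at \<tau> within ?I)"
    using ext unfolding extremal_def by blast+
  have const: "f \<tau> = 0" if der: "\<And>\<tau>. \<tau> \<in> ?I \<Longrightarrow> (f has_real_derivative 0) (at \<tau> within ?I)"
    and "f 0 = 0" and \<tau>: "\<tau> \<in> ?I" for f :: "real \<Rightarrow> real" and \<tau>
  proof -
    have "\<exists>k. \<forall>\<tau>\<in>?I. f \<tau> = k"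
      by (rule has_field_derivative_zero_constant) (auto intro: der)
    then have "f \<tau> = f 0" using \<tau> t by auto
    then show ?thesis using \<open>f 0 = 0\<close> by simp
  qed
  have t_mem: "t \<in> ?I" using t by simp
  have dsinh: "((\<lambda>\<tau>. sinh (\<psi> \<tau>)) has_real_derivative cosh (\<psi> \<tau>) * (c * x \<tau>)) (at \<tau> within ?I)" if "\<tau> \<in> ?I" for \<tau>
    by (rule DERIV_chain2[OF _ d(1)[OF that]]) (auto intro!: derivative_eq_intros)
  have dsq: "((\<lambda>\<tau>. a * (x \<tau>)\<^sup>2) has_real_derivative cosh (\<psi> \<tau>) * (c * x \<tau>)) (at \<tau> within ?I)" if "\<tau> \<in> ?I" for \<tau>
    by (rule DERIV_cong[OF DERIV_cmult[OF DERIV_power[OF d(2)[OF that]]]]) (simp add: a_def)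
  have energy: "sinh (\<psi> \<tau>) = ?s + a * (x \<tau>)\<^sup>2" if "\<tau> \<in> ?I" for \<tau>
  proof -
    have "sinh (\<psi> \<tau>) - a * (x \<tau>)\<^sup>2 - ?s = 0"
    proof (rule const[OF _ _ that])
      show "((\<lambda>\<tau>. sinh (\<psi> \<tau>) - a * (x \<tau>)\<^sup>2 - ?s) has_real_derivative 0) (at \<tau> within ?I)" if "\<tau> \<in> ?I" for \<tau>
        using DERIV_diff[OF DERIV_diff[OF dsinh[OF that] dsq[OF that]] DERIV_const] by simp
    qed (simp add: init)
    then show ?thesis by simp
  qed
  have speed: "sech_arsinh (?s + a * (x \<tau>)\<^sup>2) * cosh (\<psi> \<tau>) = 1" "tanh_arsinh (?s + a * (x \<tau>)\<^sup>2) * cosh (\<psi> \<tau>) = sinh (\<psi> \<tau>)"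
    if "\<tau> \<in> ?I" for \<tau>
    using sech_arsinh_conv_cosh[of "sinh (\<psi> \<tau>)"] by (simp_all only: energy[OF that, symmetric] arsinh_sinh_real)
  have "time_at ?s a (x t) - t = 0"
  proof (rule const[OF _ _ t_mem])
    show "((\<lambda>\<tau>. time_at ?s a (x \<tau>) - \<tau>) has_real_derivative 0) (at \<tau> within ?I)" if "\<tau> \<in> ?I" for \<tau>
      using DERIV_diff[OF DERIV_chain2[OF time_at_deriv[of ?s a] d(2)[OF that]] DERIV_ident] by (simp add: speed[OF that])
  qed (simp add: init)
  then show "time_at ?s (c / 2) (x t) = t" by (simp add: a_def)
  have "y t - y_at ?s a (x t) = 0"
  proof (rule const[OF _ _ t_mem])
    show "((\<lambda>\<tau>. y \<tau> - y_at ?s a (x \<tau>)) has_real_derivative 0) (at \<tau> within ?I)" if "\<tau> \<in> ?I" for \<tau>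
      using DERIV_diff[OF d(3)[OF that] DERIV_chain2[OF y_at_deriv[of ?s a] d(2)[OF that]]] by (simp add: speed[OF that])
  qed (simp add: init)
  then show "y t = y_at ?s (c / 2) (x t)" by (simp add: a_def)
  have "z t - z_at ?s a (x t) = 0"
  proof (rule const[OF _ _ t_mem])
    show "((\<lambda>\<tau>. z \<tau> - z_at ?s a (x \<tau>)) has_real_derivative 0) (at \<tau> within ?I)" if "\<tau> \<in> ?I" for \<tau>
      using DERIV_diff[OF d(4)[OF that] DERIV_chain2[OF z_at_deriv[of ?s a] d(2)[OF that]]]
      by (simp add: speed[OF that] mult.assoc)
  qed (simp add: init)
  then show "z t = z_at ?s (c / 2) (x t)" by (simp add: a_def)
qed

text \<open>
  The abscissa of the extremal is the inverse function of time; the other components are then read off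
  from the first integral.
\<close>

lemma extremal_exists:
  assumes x0: "0 < x0" "time_at (sinh \<psi>0) (c / 2) x0 = t"
  shows "\<exists>\<psi> x y z. extremal \<psi>0 c {0..t} \<psi> x y z \<and> x t = x0"
proof -
  let ?s = "sinh \<psi>0"
  define a where "a = c / 2"
  let ?\<theta> = "time_at ?s a"
  define x where "x = inv ?\<theta>"
  have inj: "inj ?\<theta>" using strict_mono_time_at by (rule strict_mono_imp_inj_on)
  have x\<theta>: "x (?\<theta> \<xi>) = \<xi>" for \<xi> unfolding x_def by (rule inv_f_f[OF inj])
  have dx: "(x has_real_derivative cosh (arsinh (?s + a * \<xi>\<^sup>2))) (at (?\<theta> \<xi>))" for \<xi>
  proof -
    have "(x has_real_derivative inverse (sech_arsinh (?s + a * \<xi>\<^sup>2))) (at (?\<theta> \<xi>))"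
    proof (rule DERIV_inverse_function[where a = "?\<theta> (\<xi> - 1)" and b = "?\<theta> (\<xi> + 1)"])
      show "(?\<theta> has_real_derivative sech_arsinh (?s + a * \<xi>\<^sup>2)) (at (x (?\<theta> \<xi>)))"
        unfolding x\<theta> by (rule time_at_deriv)
      show "sech_arsinh (?s + a * \<xi>\<^sup>2) \<noteq> 0" using sech_arsinh_pos[of "?s + a * \<xi>\<^sup>2"] by simp
      show "?\<theta> (\<xi> - 1) < ?\<theta> \<xi>" "?\<theta> \<xi> < ?\<theta> (\<xi> + 1)"
        using strict_mono_time_at by (simp_all add: strict_mono_less)
      show "?\<theta> (x u) = u" if u: "?\<theta> (\<xi> - 1) < u" "u < ?\<theta> (\<xi> + 1)" for u
      proof -
        obtain \<zeta> where "?\<theta> \<zeta> = u"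
          using IVT[of ?\<theta> "\<xi> - 1" u "\<xi> + 1"] u isCont_time_at by auto
        then show ?thesis using x\<theta> by metis
      qed
      show "isCont x (?\<theta> \<xi>)"
        by (rule isCont_inverse_function[of 1]) (auto simp: x\<theta> isCont_time_at)
    qed
    moreover have "inverse (sech_arsinh (?s + a * \<xi>\<^sup>2)) = cosh (arsinh (?s + a * \<xi>\<^sup>2))"
      using sech_arsinh_conv_cosh(1) by (rule inverse_unique)
    ultimately show ?thesis by simp
  qed
  have x_0: "x 0 = 0" using x\<theta>[of 0] by simp
  have "extremal \<psi>0 c {0..t} (\<lambda>\<tau>. arsinh (?s + a * (x \<tau>)\<^sup>2)) x (\<lambda>\<tau>. y_at ?s a (x \<tau>)) (\<lambda>\<tau>. z_at ?s a (x \<tau>))"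
    unfolding extremal_def
  proof (intro conjI ballI)
    show "arsinh (?s + a * (x 0)\<^sup>2) = \<psi>0" by (simp add: x_0 arsinh_sinh_real)
    show "x 0 = 0" "y_at ?s a (x 0) = 0" "z_at ?s a (x 0) = 0" by (simp_all add: x_0)
    fix \<tau> assume "\<tau> \<in> {0..t}"
    then obtain \<xi> where \<xi>: "\<tau> = ?\<theta> \<xi>"
      using IVT[of ?\<theta> 0 \<tau> x0] x0[folded a_def] isCont_time_at by auto
    let ?v = "?s + a * \<xi>\<^sup>2"
    have X: "x \<tau> = \<xi>" and dX: "(x has_real_derivative cosh (arsinh ?v)) (at \<tau> within {0..t})"
      using has_field_derivative_at_within[OF dx[of \<xi>]] by (simp_all add: \<xi> x\<theta>)
    show "(x has_real_derivative cosh (arsinh (?s + a * (x \<tau>)\<^sup>2))) (at \<tau> within {0..t})"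
      using dX by (simp add: X)
    have "(y_at ?s a has_real_derivative tanh_arsinh ?v) (at (x \<tau>))" unfolding X by (rule y_at_deriv)
    from DERIV_chain2[OF this dX]
    show "((\<lambda>\<tau>. y_at ?s a (x \<tau>)) has_real_derivative sinh (arsinh (?s + a * (x \<tau>)\<^sup>2))) (at \<tau> within {0..t})"
      by (simp add: X sech_arsinh_conv_cosh)
    have "(z_at ?s a has_real_derivative \<xi>\<^sup>2 / 2 * tanh_arsinh ?v) (at (x \<tau>))" unfolding X by (rule z_at_deriv)
    from DERIV_chain2[OF this dX]
    show "((\<lambda>\<tau>. z_at ?s a (x \<tau>)) has_real_derivative (x \<tau>)\<^sup>2 / 2 * sinh (arsinh (?s + a * (x \<tau>)\<^sup>2))) (at \<tau> within {0..t})"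
      by (simp add: X mult.assoc sech_arsinh_conv_cosh)
    have "(arsinh has_real_derivative sech_arsinh ?v) (at ?v)"
      by (auto intro!: derivative_eq_intros simp: sech_arsinh_def add.commute)
    moreover have "((\<lambda>\<tau>. ?s + a * (x \<tau>)\<^sup>2) has_real_derivative c * x \<tau> * cosh (arsinh ?v)) (at \<tau> within {0..t})"
      by (rule DERIV_cong[OF DERIV_add[OF DERIV_const DERIV_cmult[OF DERIV_power[OF dX]]]]) (simp add: a_def X)
    ultimately have "((\<lambda>\<tau>. arsinh (?s + a * (x \<tau>)\<^sup>2)) has_real_derivative sech_arsinh ?v * (c * x \<tau> * cosh (arsinh ?v))) (at \<tau> within {0..t})"
      by (intro DERIV_chain2[of arsinh]) (simp_all only: X)
    moreover have "sech_arsinh ?v * (c * x \<tau> * cosh (arsinh ?v)) = c * x \<tau>"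
      using sech_arsinh_conv_cosh(1)[of ?v] by algebra
    ultimately show "((\<lambda>\<tau>. arsinh (?s + a * (x \<tau>)\<^sup>2)) has_real_derivative c * x \<tau>) (at \<tau> within {0..t})"
      by simp
  qed
  moreover have "x t = x0" using x0(2)[folded a_def] x\<theta> by metis
  ultimately show ?thesis by blast
qed

lemma charts_conv:
  assumes "x \<noteq> 0"
  shows "time_chart sech_arsinh (\<psi>, b, x) = (\<psi>, 2 * b / x\<^sup>2, time_at (sinh \<psi>) (b / x\<^sup>2) x)"
    and "endpoint_chart tanh_arsinh (\<psi>, b, x) = (x, y_at (sinh \<psi>) (b / x\<^sup>2) x, z_at (sinh \<psi>) (b / x\<^sup>2) x)"
  using assms by (simp_all add: time_chart_def endpoint_chart_def time_at_def y_at_def z_at_def)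

text \<open>
  Time determines the abscissa, so at the time given by the first chart every extremal with these
  parameters has abscissa \<open>x\<close>, and its other coordinates there are functions of \<open>x\<close>.
\<close>

lemma Exp_map_time_chart:
  assumes "u \<in> real_charts_domain"
  shows "Exp_map (time_chart sech_arsinh u) = endpoint_chart tanh_arsinh u"
proof -
  obtain \<psi>0 b x0 where u: "u = (\<psi>0, b, x0)" by (cases u)
  have x0: "0 < x0" using assms by (simp add: u real_charts_domain_def)
  define c where "c = 2 * b / x0\<^sup>2"
  have a: "b / x0\<^sup>2 = c / 2" by (simp add: c_def)
  define t where "t = time_at (sinh \<psi>0) (c / 2) x0"
  have P: "time_chart sech_arsinh u = (\<psi>0, c, t)" 
    and Q: "endpoint_chart tanh_arsinh u = (x0, y_at (sinh \<psi>0) (c / 2) x0, z_at (sinh \<psi>0) (c / 2) x0)"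
    using x0 charts_conv[of x0 \<psi>0 b] unfolding u a t_def by (simp_all add: c_def)
  have t: "0 < t" using strict_mono_less[OF strict_mono_time_at, of "sinh \<psi>0" "c / 2" 0 x0] x0 by (simp add: t_def)
  have endpt: "(x t, y t, z t) = endpoint_chart tanh_arsinh u" if "extremal \<psi>0 c {0..t} \<psi> x y z" for \<psi> x y z
  proof -
    note e = extremal_endpoint[OF that less_imp_le[OF t]]
    have "x t = x0"
      using e(1) strict_mono_eq[OF strict_mono_time_at] unfolding t_def by blast
    then show ?thesis using e(2,3) Q by simp
  qed
  show ?thesis
    unfolding P Exp_map_def prod.case
  proof (rule the_equality)
    show "\<exists>\<psi> x y z. extremal \<psi>0 c {0..t} \<psi> x y z \<and> endpoint_chart tanh_arsinh u = (x t, y t, z t)"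
      using extremal_exists[OF x0 t_def[symmetric]] endpt by metis
    show "q = endpoint_chart tanh_arsinh u"
      if "\<exists>\<psi> x y z. extremal \<psi>0 c {0..t} \<psi> x y z \<and> q = (x t, y t, z t)" for q
      using that endpt by metis
  qed
qed

lemma time_chart_inj: "inj_on (time_chart sech_arsinh) real_charts_domain"
proof (rule inj_onI)
  fix u v assume u: "u \<in> real_charts_domain" and v: "v \<in> real_charts_domain"
    and eq: "time_chart sech_arsinh u = time_chart sech_arsinh v"
  obtain \<psi> b x where uf: "u = (\<psi>, b, x)" by (cases u)
  obtain \<psi>' b' x' where vf: "v = (\<psi>', b', x')" by (cases v)
  have pos: "0 < x" "0 < x'" using u v by (simp_all add: uf vf real_charts_domain_def)
  then have e: "\<psi> = \<psi>'" "b / x\<^sup>2 = b' / x'\<^sup>2" "time_at (sinh \<psi>) (b / x\<^sup>2) x = time_at (sinh \<psi>') (b' / x'\<^sup>2) x'"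
    using eq unfolding uf vf by (auto simp: charts_conv)
  then have "x = x'" using strict_mono_eq[OF strict_mono_time_at] by metis
  then show "u = v" using e pos by (simp add: uf vf)
qed

lemma time_chart_image:
  "time_chart sech_arsinh ` real_charts_domain = {(\<psi>, c, t). \<exists>x>0. time_at (sinh \<psi>) (c / 2) x = t}"
proof (intro subset_antisym subsetI)
  fix p assume "p \<in> time_chart sech_arsinh ` real_charts_domain"
  then show "p \<in> {(\<psi>, c, t). \<exists>x>0. time_at (sinh \<psi>) (c / 2) x = t}"
    by (auto simp: real_charts_domain_def charts_conv)
next
  fix p assume "p \<in> {(\<psi>, c, t). \<exists>x>0. time_at (sinh \<psi>) (c / 2) x = t}"
  then obtain \<psi> c x where p: "p = (\<psi>, c, time_at (sinh \<psi>) (c / 2) x)" and x: "0 < x" by auto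
  have "p = time_chart sech_arsinh (\<psi>, c * x\<^sup>2 / 2, x)"
    using x by (simp add: p charts_conv)
  then show "p \<in> time_chart sech_arsinh ` real_charts_domain"
    using x by (auto simp: real_charts_domain_def intro!: image_eqI)
qed

section \<open>The lifetime as a complete elliptic integral\<close>

text \<open>
  The substitution \<open>x = \<mu> tan (\<phi> / 2)\<close> turns the time differential into the elliptic one. Here \<open>S\<close> and \<open>C\<close> stand for
  sine and cosine of \<open>\<phi> / 2\<close>, \<open>\<epsilon>\<close> for the sign of \<open>c\<close>, and \<open>R = cosh \<psi>0\<close>; the square of the modulus is
  \<open>(1 - \<epsilon> s / R) / 2\<close>.
\<close>

lemma tan_half_kernel:
  fixes s R \<epsilon> S C :: real
  assumes R: "0 < R" "R\<^sup>2 = 1 + s\<^sup>2" and \<epsilon>: "\<epsilon>\<^sup>2 = 1" and SC: "C\<^sup>2 + S\<^sup>2 = 1" "C \<noteq> 0"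
  shows "sech_arsinh (s + \<epsilon> * R * (S / C)\<^sup>2) / C\<^sup>2 = 1 / (R * sqrt (1 - (1 - \<epsilon> * s / R) / 2 * (2 * S * C)\<^sup>2))"
proof -
  define v where "v = s + \<epsilon> * R * (S / C)\<^sup>2"
  define w where "w = v * C\<^sup>2"
  have w: "w = s * C\<^sup>2 + \<epsilon> * R * S\<^sup>2"
    using SC(2) by (simp add: w_def v_def power_divide distrib_right)
  have "R\<^sup>2 * (1 - (1 - \<epsilon> * s / R) / 2 * (2 * S * C)\<^sup>2) = R\<^sup>2 - 2 * R\<^sup>2 * S\<^sup>2 * C\<^sup>2 + 2 * \<epsilon> * s * R * S\<^sup>2 * C\<^sup>2"
    using R(1) by (simp add: field_simps power2_eq_square)
  also have "\<dots> = (C\<^sup>2)\<^sup>2 + w\<^sup>2"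
    using R(2) \<epsilon> SC(1) unfolding w by algebra
  also have "\<dots> = (1 + v\<^sup>2) * (C\<^sup>2)\<^sup>2"
    by (simp add: w_def algebra_simps power2_eq_square)
  finally have "sqrt (1 + v\<^sup>2) * sqrt ((C\<^sup>2)\<^sup>2) = sqrt (R\<^sup>2) * sqrt (1 - (1 - \<epsilon> * s / R) / 2 * (2 * S * C)\<^sup>2)"
    by (simp only: real_sqrt_mult[symmetric])
  then have "sqrt (1 + v\<^sup>2) * C\<^sup>2 = R * sqrt (1 - (1 - \<epsilon> * s / R) / 2 * (2 * S * C)\<^sup>2)"
    using R(1) by (simp only: real_sqrt_abs abs_power2 abs_of_pos)
  then show ?thesis by (simp add: sech_arsinh_def flip: v_def)
qed

text \<open>
  For \<open>c \<noteq> 0\<close> the time at \<open>x = \<mu> tan (\<phi> / 2)\<close> is a constant times the incomplete integral \<open>G \<phi>\<close>, by comparison of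
  derivatives. As \<open>x\<close> runs through the positive reals, \<open>\<phi>\<close> runs through \<open>(0, \<pi>)\<close>, so the times attained fill the
  interval up to the value at \<open>\<pi>\<close>; by symmetry about \<open>\<pi> / 2\<close> this is twice the complete integral.
\<close>

lemma exists_time_at_iff:
  "(\<exists>x>0. time_at (sinh \<psi>) (c / 2) x = t) \<longleftrightarrow> 0 < t \<and> ereal t < lifetime \<psi> c"
proof (cases "c = 0")
  case True
  have "time_at (sinh \<psi>) 0 x = x * sech_arsinh (sinh \<psi>)" for x
    by (simp add: time_at_def moment_def)
  moreover have "(\<exists>x>0. x * sech_arsinh (sinh \<psi>) = t) \<longleftrightarrow> 0 < t"
    using sech_arsinh_pos[of "sinh \<psi>"] by (auto intro!: exI[of _ "t / sech_arsinh (sinh \<psi>)"])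
  ultimately show ?thesis using True by (simp add: lifetime_def)
next
  case False
  define s where "s = sinh \<psi>"
  define R where "R = sqrt (1 + s\<^sup>2)"
  define \<epsilon> where "\<epsilon> = sgn c"
  define kk where "kk = (1 - \<epsilon> * s / R) / 2"
  \<comment> \<open>At this scale the coefficients of \<open>T\<^sup>0\<close> and \<open>T\<^sup>4\<close> in \<open>1 + (s + a (\<mu> T)\<^sup>2)\<^sup>2\<close> are both \<open>R\<^sup>2\<close>.\<close>
  define \<mu> where "\<mu> = sqrt (2 * R / \<bar>c\<bar>)"
  define a where "a = c / 2"
  have R: "0 < R" "R\<^sup>2 = 1 + s\<^sup>2"
    using sqrt_one_plus_square_pos[of s] one_plus_square_pos[of s] by (simp_all add: R_def)
  have \<epsilon>: "\<epsilon>\<^sup>2 = 1" "\<bar>\<epsilon>\<bar> = 1" "\<epsilon> * \<bar>c\<bar> = c" using False by (simp_all add: \<epsilon>_def sgn_if)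
  have \<mu>: "0 < \<mu>" "\<mu>\<^sup>2 = 2 * R / \<bar>c\<bar>" using R(1) False by (simp_all add: \<mu>_def)
  have a\<mu>: "a * (\<mu> * T)\<^sup>2 = \<epsilon> * R * T\<^sup>2" for T
  proof -
    have "a * \<mu>\<^sup>2 = \<epsilon> * R"
      unfolding \<mu>(2) a_def using False by (simp add: \<epsilon>_def sgn_if)
    then show ?thesis by (simp add: power_mult_distrib mult.assoc[symmetric])
  qed
  have "\<bar>s\<bar> < R"
    unfolding R_def by (rule real_less_rsqrt) simp
  then have "\<bar>\<epsilon> * s / R\<bar> < 1" using R(1) \<epsilon>(2) by (simp add: abs_mult)
  then have "\<epsilon> * s / R < 1 \<and> - (\<epsilon> * s / R) < 1" by (simp only: abs_less_iff)
  then have kk: "0 \<le> kk" "kk < 1" unfolding kk_def by auto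
  define q where "q \<theta> = 1 / sqrt (1 - kk * (sin \<theta>)\<^sup>2)" for \<theta>
  have pos: "0 < 1 - kk * (sin \<theta>)\<^sup>2" for \<theta>
  proof -
    have "kk * (sin \<theta>)\<^sup>2 \<le> kk * 1" using kk by (intro mult_left_mono) (simp_all add: abs_square_le_1)
    then show ?thesis using kk by linarith
  qed
  have q1: "1 \<le> q \<theta>" for \<theta>
    using pos[of \<theta>] kk by (simp add: q_def)
  have contq: "continuous_on A q" for A
    unfolding q_def[abs_def] using pos by (intro continuous_intros) (auto simp: less_imp_neq[symmetric])
  define G where "G \<phi> = integral {0..\<phi>} q" for \<phi>
  have dG: "(G has_real_derivative q \<phi>) (at \<phi> within {0..pi})" if "\<phi> \<in> {0..pi}" for \<phi>
    unfolding G_def[abs_def] by (rule integral_has_real_derivative[OF contq that])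
  have G0: "G 0 = 0" by (simp add: G_def)
  have G_less: "G \<phi> < G pi" if "\<phi> \<in> {0..<pi}" for \<phi>
  proof -
    have "G \<phi> + integral {\<phi>..pi} q = G pi"
      unfolding G_def by (rule Henstock_Kurzweil_Integration.integral_combine)
        (use that contq in \<open>auto intro: integrable_continuous_interval\<close>)
    moreover have "pi - \<phi> \<le> integral {\<phi>..pi} q"
      using has_integral_le[OF has_integral_const_real[of 1 \<phi> pi]
          integrable_integral[OF integrable_continuous_interval[OF contq]]] q1 that by simp
    ultimately show ?thesis using that by simp
  qed
  have G_pi: "G pi = 2 * G (pi / 2)"
  proof -
    \<comment> \<open>The integrand is symmetric about \<open>pi / 2\<close>, so this sum is constant; its values at \<open>0\<close> and \<open>pi / 2\<close> are compared.\<close>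
    have "\<exists>k. \<forall>\<phi>\<in>{0..pi}. G (pi - \<phi>) + G \<phi> = k"
    proof (rule has_field_derivative_zero_constant)
      fix \<phi> assume \<phi>: "\<phi> \<in> {0..pi}"
      have img: "(\<lambda>\<phi>. pi - \<phi>) ` {0..pi} = {0..pi}" by simp
      have "(G has_real_derivative q (pi - \<phi>)) (at (pi - \<phi>) within (\<lambda>\<phi>. pi - \<phi>) ` {0..pi})"
        unfolding img by (rule dG) (use \<phi> in auto)
      moreover have "((\<lambda>\<phi>. pi - \<phi>) has_real_derivative - 1) (at \<phi> within {0..pi})"
        by (auto intro!: derivative_eq_intros)
      ultimately have "((G \<circ> (\<lambda>\<phi>. pi - \<phi>)) has_real_derivative q (pi - \<phi>) * - 1) (at \<phi> within {0..pi})"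
        by (rule DERIV_image_chain)
      from DERIV_add[OF this dG[OF \<phi>]]
      show "((\<lambda>\<phi>. G (pi - \<phi>) + G \<phi>) has_real_derivative 0) (at \<phi> within {0..pi})"
        by (simp add: q_def)
    qed simp
    then obtain k where k: "\<And>\<phi>. \<phi> \<in> {0..pi} \<Longrightarrow> G (pi - \<phi>) + G \<phi> = k" by blast
    from k[of 0] k[of "pi / 2"] show ?thesis by (simp add: G0)
  qed
  have time_G: "time_at s a (\<mu> * tan (\<phi> / 2)) = \<mu> / (2 * R) * G \<phi>" if \<phi>: "\<phi> \<in> {0..<pi}" for \<phi>
  proof -
    have "\<exists>k. \<forall>\<phi>\<in>{0..<pi}. time_at s a (\<mu> * tan (\<phi> / 2)) - \<mu> / (2 * R) * G \<phi> = k"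
    proof (rule has_field_derivative_zero_constant)
      fix \<phi> assume \<phi>: "\<phi> \<in> {0..<pi}"
      have C: "cos (\<phi> / 2) \<noteq> 0" using cos_gt_zero_pi[of "\<phi> / 2"] \<phi> by auto
      have dtan: "((\<lambda>\<phi>. \<mu> * tan (\<phi> / 2)) has_real_derivative \<mu> / (2 * (cos (\<phi> / 2))\<^sup>2)) (at \<phi> within {0..<pi})"
        using C by (auto intro!: derivative_eq_intros simp: field_simps)
      have dtime: "((\<lambda>\<phi>. time_at s a (\<mu> * tan (\<phi> / 2))) has_real_derivative
          sech_arsinh (s + a * (\<mu> * tan (\<phi> / 2))\<^sup>2) * (\<mu> / (2 * (cos (\<phi> / 2))\<^sup>2))) (at \<phi> within {0..<pi})"
        by (rule DERIV_chain2[OF time_at_deriv dtan])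
      have speed: "sech_arsinh (s + a * (\<mu> * tan (\<phi> / 2))\<^sup>2) * (\<mu> / (2 * (cos (\<phi> / 2))\<^sup>2)) = \<mu> / (2 * R) * q \<phi>"
      proof -
        have "sech_arsinh (s + a * (\<mu> * tan (\<phi> / 2))\<^sup>2) * (\<mu> / (2 * (cos (\<phi> / 2))\<^sup>2))
          = \<mu> / 2 * (sech_arsinh (s + \<epsilon> * R * (sin (\<phi> / 2) / cos (\<phi> / 2))\<^sup>2) / (cos (\<phi> / 2))\<^sup>2)"
          unfolding a\<mu> by (simp add: tan_def)
        also have "\<dots> = \<mu> / 2 * (1 / (R * sqrt (1 - kk * (2 * sin (\<phi> / 2) * cos (\<phi> / 2))\<^sup>2)))"
          unfolding kk_def using tan_half_kernel[OF R \<epsilon>(1) _ C, of "sin (\<phi> / 2)"] by simp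
        also have "2 * sin (\<phi> / 2) * cos (\<phi> / 2) = sin \<phi>"
          using sin_double[of "\<phi> / 2"] by simp
        finally show ?thesis by (simp add: q_def)
      qed
      have dG': "(G has_real_derivative q \<phi>) (at \<phi> within {0..<pi})"
        by (rule DERIV_subset[OF dG]) (use \<phi> in auto)
      show "((\<lambda>\<phi>. time_at s a (\<mu> * tan (\<phi> / 2)) - \<mu> / (2 * R) * G \<phi>) has_real_derivative 0) (at \<phi> within {0..<pi})"
        using DERIV_diff[OF dtime DERIV_cmult[OF dG', of "\<mu> / (2 * R)"]] by (simp only: speed diff_self)
    qed simp
    then obtain k where k: "\<And>\<phi>. \<phi> \<in> {0..<pi} \<Longrightarrow> time_at s a (\<mu> * tan (\<phi> / 2)) - \<mu> / (2 * R) * G \<phi> = k" by blast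
    from k[of 0] k[OF \<phi>] show ?thesis by (simp add: G0)
  qed
  have lifetime: "lifetime \<psi> c = ereal (\<mu> / (2 * R) * G pi)"
  proof -
    define k where "k = sqrt (1 / 2 * (1 + sgn c * (- s / R)))"
    define ae where "ae = sqrt (R / 2)"
    have "1 / 2 * (1 + sgn c * (- s / R)) = kk" by (simp add: kk_def \<epsilon>_def)
    then have "k\<^sup>2 = kk" using kk by (simp add: k_def)
    then have "elliptic_K k = G (pi / 2)" by (simp add: elliptic_K_def G_def q_def[abs_def])
    moreover have "\<mu> * (ae * sqrt \<bar>c\<bar>) = R"
    proof -
      have "\<mu> * (ae * sqrt \<bar>c\<bar>) = sqrt (2 * R / \<bar>c\<bar> * (R / 2 * \<bar>c\<bar>))"
        by (simp only: \<mu>_def ae_def real_sqrt_mult)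
      also have "2 * R / \<bar>c\<bar> * (R / 2 * \<bar>c\<bar>) = R\<^sup>2" using False by (simp add: power2_eq_square)
      finally show ?thesis using R(1) by simp
    qed
    moreover have "lifetime \<psi> c = ereal (elliptic_K k / (ae * sqrt \<bar>c\<bar>))"
      using False by (simp add: lifetime_def Let_def k_def ae_def R_def s_def)
    moreover have "0 < ae * sqrt \<bar>c\<bar>" using R(1) False by (simp add: ae_def)
    moreover have "g / d = \<mu> / (2 * (\<mu> * d)) * (2 * g)" if "0 < d" for g d
      using that \<mu>(1) by simp
    ultimately show ?thesis by (metis G_pi)
  qed
  have "(\<exists>x>0. time_at s a x = t) \<longleftrightarrow> 0 < t \<and> t < \<mu> / (2 * R) * G pi"
  proof
    assume "\<exists>x>0. time_at s a x = t"
    then obtain x where x: "0 < x" "time_at s a x = t" by blast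
    define \<phi> where "\<phi> = 2 * arctan (x / \<mu>)"
    have \<phi>: "\<phi> \<in> {0..<pi}" using x \<mu>(1) arctan_ubound[of "x / \<mu>"] by (simp add: \<phi>_def)
    have "\<mu> * tan (\<phi> / 2) = x" using \<mu>(1) by (simp add: \<phi>_def tan_arctan)
    then have "t = \<mu> / (2 * R) * G \<phi>" using time_G[OF \<phi>] x by simp
    also have "\<dots> < \<mu> / (2 * R) * G pi"
      using G_less[OF \<phi>] \<mu>(1) R(1) by (intro mult_strict_left_mono) auto
    finally show "0 < t \<and> t < \<mu> / (2 * R) * G pi"
      using x strict_mono_less[OF strict_mono_time_at, of s a 0 x] by simp
  next
    assume t: "0 < t \<and> t < \<mu> / (2 * R) * G pi"
    have "continuous_on {0..pi} (\<lambda>\<phi>. \<mu> / (2 * R) * G \<phi>)"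
      using DERIV_continuous_on[OF dG] by (intro continuous_intros) auto
    then obtain \<phi> where \<phi>: "0 \<le> \<phi>" "\<phi> \<le> pi" "\<mu> / (2 * R) * G \<phi> = t"
      using IVT'[of "\<lambda>\<phi>. \<mu> / (2 * R) * G \<phi>" 0 t pi] t by (auto simp: G0)
    then have "\<phi> \<noteq> 0" "\<phi> \<noteq> pi" using t by (auto simp: G0)
    then have \<phi>': "0 < \<phi>" "\<phi> < pi" using \<phi> by auto
    then have "0 < \<mu> * tan (\<phi> / 2)" using \<mu>(1) tan_gt_zero[of "\<phi> / 2"] by simp
    moreover have "time_at s a (\<mu> * tan (\<phi> / 2)) = t" using time_G[of \<phi>] \<phi>' \<phi>(3) by simp
    ultimately show "\<exists>x>0. time_at s a x = t" by blast
  qed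
  then show ?thesis by (simp add: lifetime s_def a_def)
qed

section \<open>The exponential mapping is a diffeomorphism\<close>

theorem proposition14:
  "Exp_map ` Exp_dom \<subseteq> interior B2 \<and>
   real_analytic_diffeomorphism Exp_map Exp_dom (interior B2)"
proof -
  let ?U = real_charts_domain and ?P = "time_chart sech_arsinh" and ?Q = "endpoint_chart tanh_arsinh"
  have dom: "?P ` ?U = Exp_dom"
    unfolding time_chart_image Exp_dom_def exists_time_at_iff ..
  have transitions: "real_analytic_on f (?P ` ?U) \<and> open (?P ` ?U)" if "\<And>u. u \<in> ?U \<Longrightarrow> f (?P u) = ?Q u" for f
    using real_analytic_chart_transitions(1)[OF time_chart_inj, of f] that by blast
  have transitions': "real_analytic_on g (?Q ` ?U) \<and> open (?Q ` ?U)" if "\<And>u. u \<in> ?U \<Longrightarrow> g (?Q u) = ?P u" for g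
    using real_analytic_chart_transitions(2)[of g] endpoint_chart_inj that by blast
  have exp: "Exp_map (?P u) = ?Q u" if "u \<in> ?U" for u
    using that by (rule Exp_map_time_chart)
  have inj: "inj_on Exp_map Exp_dom"
    unfolding dom[symmetric] using endpoint_chart_inj by (auto simp: inj_on_def exp)
  have image: "Exp_map ` Exp_dom = ?Q ` ?U"
    unfolding dom[symmetric] image_image by (rule image_cong) (simp_all add: exp)
  have inverse: "the_inv_into Exp_dom Exp_map (?Q u) = ?P u" if "u \<in> ?U" for u
    using that inj by (intro the_inv_into_f_eq) (auto simp: exp dom[symmetric])
  \<comment> \<open>The image is open, so lying in the closed region it lies in the interior.\<close>
  have "?Q ` ?U \<subseteq> B2" using endpoint_chart_in_B2 by auto
  then have B2: "?Q ` ?U = interior B2"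
    using interior_B2_subset interior_maximal transitions'[OF inverse] by blast
  show ?thesis
    unfolding real_analytic_diffeomorphism_def bij_betw_def
    using transitions[OF exp] transitions'[OF inverse] inj image by (simp add: dom B2)
qed

end
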